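(* Let $k\ge 0$ and let $\pi$ be a set of $q$ pairwise disjoint two-element subsets of $\{1,\dots,k\}$; let $m=k-2q$ and let $i_1<\dots<i_m$ be the indices not belonging to any pair of $\pi$. For $n\ge 1$ let $F_{\pi,n}(x_{i_1},\dots,x_{i_m})$ be the $m$-linear form on $sp(n)$ obtained from the $k$-linear form $f(x_1,\dots,x_k)=\mathrm{Tr}(\mathrm{ad}_{x_1}\cdots \mathrm{ad}_{x_k})$ by contracting along all pairs of $\pi$. Then there are finitely many expressions $T$, each a product of traces of products of the matrices $x_{i_j}$ and $x_{i_j}^{*}$, and polynomials $p_T$ in one variable (depending only on $k$ and $\pi$, not on $n$) such that $F_{\pi,n}(x_{i_1},\dots,x_{i_m})=\sum_T p_T(n)\,T(x_{i_1},\dots,x_{i_m})$ for all $n\ge 1$ and all $x_{i_1},\dots,x_{i_m}\in sp(n)$.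
   Context: Work over a field of characteristic $0$. $sp(n)$ is the Lie algebra of $2n\times2n$ matrices $X$ with $jX+X^{*}j=0$, where $j=\begin{pmatrix}0&E\\-E&0\end{pmatrix}$, $E$ is the $n\times n$ identity matrix and $X^{*}$ is the transpose of $X$. $\mathrm{ad}_x(u)=[x,u]=xu-ux$ on $sp(n)$, and $\mathrm{Tr}(\mathrm{ad}_{x_1}\cdots\mathrm{ad}_{x_k})$ is the trace of a linear operator on $sp(n)$ (for $k=0$ the trace of the identity operator). In the expressions $T$, traces are ordinary traces of $2n\times 2n$ matrices, and the empty product of traces is $1$. Contracting along a pair $\{a,b\}$ means replacing the form by $\sum_{\alpha} f(\dots,\alpha,\dots,\tilde\alpha,\dots)$, where the arguments $x_a,x_b$ are replaced by $\alpha,\tilde\alpha$, $\alpha$ runs over a basis of $sp(n)$ and $\tilde\alpha$ over the corresponding dual basis with respect to the form $\langle X,Y\rangle=\mathrm{Tr}(XY)$ (trace of the $2n\times2n$ matrix). Contracting along $\pi$ means doing this for every pair of $\pi$. The result does not depend on the choice of basis. *)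

theory Defs
  imports "Jordan_Normal_Form.VS_Connect"
begin

definition mtrace :: "'a::comm_monoid_add mat \<Rightarrow> 'a" where
  "mtrace A = (\<Sum>i<dim_row A. A $$ (i, i))"

definition sp_form :: "nat \<Rightarrow> 'a::ring_1 mat" where
  "sp_form n = four_block_mat (0\<^sub>m n n) (1\<^sub>m n) (- 1\<^sub>m n) (0\<^sub>m n n)"

definition sp :: "nat \<Rightarrow> 'a::ring_1 mat set" where
  "sp n = {X \<in> carrier_mat (2 * n) (2 * n).
             sp_form n * X + transpose_mat X * sp_form n = 0\<^sub>m (2 * n) (2 * n)}"

definition sp_space :: "nat \<Rightarrow> ('a::ring_1, 'a mat) module" where
  "sp_space n = (module_mat TYPE('a) (2 * n) (2 * n)) \<lparr>carrier := sp n\<rparr>"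

(* Only the values on B matter; they are unique if B is a basis and v lies in the space. *)
definition coords :: "('a::field, 'v) module \<Rightarrow> 'v set \<Rightarrow> 'v \<Rightarrow> 'v \<Rightarrow> 'a" where
  "coords V B v = (SOME c. v = module.lincomb V c B)"

(* Sum of the diagonal entries of the matrix of the operator in a basis (the choice of the
   basis is immaterial for linear operators on finite-dimensional spaces). *)
definition op_trace :: "('a::field, 'v) module \<Rightarrow> ('v \<Rightarrow> 'v) \<Rightarrow> 'a" where
  "op_trace V A =
     (let B = (SOME B. vectorspace.basis class_ring V B) in \<Sum>b\<in>B. coords V B (A b) b)"

definition ad :: "'a::ring_1 mat \<Rightarrow> 'a mat \<Rightarrow> 'a mat" where
  "ad x u = x * u - u * x"

(* A k-linear form is a function of an assignment i \<mapsto> x i of matrices to argument positions;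
   only the values at the positions 1, ..., k matter. *)
definition ad_trace_form :: "nat \<Rightarrow> nat \<Rightarrow> (nat \<Rightarrow> 'a::field mat) \<Rightarrow> 'a" where
  "ad_trace_form n k x =
     op_trace (sp_space n) (foldr (\<lambda>i g. ad (x i) \<circ> g) [1..<Suc k] id)"

definition dual_basis :: "nat \<Rightarrow> 'a::field mat set \<Rightarrow> ('a mat \<Rightarrow> 'a mat) \<Rightarrow> bool" where
  "dual_basis n B D \<longleftrightarrow> D \<in> B \<rightarrow> sp n \<and>
     (\<forall>\<alpha>\<in>B. \<forall>\<beta>\<in>B. mtrace (\<alpha> * D \<beta>) = (if \<alpha> = \<beta> then 1 else 0))"

(* P = {a, b} is an unordered pair; its smaller element receives \<alpha>, its larger one the dual D \<alpha>.
   As the bilinear form is symmetric, the other choice gives the same result for multilinear f. *)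
definition contract_pair ::
  "'a mat set \<Rightarrow> ('a mat \<Rightarrow> 'a mat) \<Rightarrow> nat set \<Rightarrow> ((nat \<Rightarrow> 'a mat) \<Rightarrow> 'a::field) \<Rightarrow>
     (nat \<Rightarrow> 'a mat) \<Rightarrow> 'a" where
  "contract_pair B D P f = (\<lambda>x. \<Sum>\<alpha>\<in>B. f (x(Min P := \<alpha>, Max P := D \<alpha>)))"

definition contract ::
  "'a mat set \<Rightarrow> ('a mat \<Rightarrow> 'a mat) \<Rightarrow> nat set set \<Rightarrow> ((nat \<Rightarrow> 'a mat) \<Rightarrow> 'a::field) \<Rightarrow>
     (nat \<Rightarrow> 'a mat) \<Rightarrow> 'a" where
  "contract B D \<pi> f = Finite_Set.fold (contract_pair B D) f \<pi>"

(* For pairwise disjoint pairs the fold above does not depend on the order. *)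
lemma contract_pair_commute:
  assumes "disjoint \<pi>" "\<And>P. P \<in> \<pi> \<Longrightarrow> card P = 2"
  shows "Finite_Set.comp_fun_commute_on \<pi> (contract_pair B D)"
proof
  fix P Q assume PQ: "P \<in> \<pi>" "Q \<in> \<pi>"
  show "contract_pair B D Q \<circ> contract_pair B D P = contract_pair B D P \<circ> contract_pair B D Q"
  proof (cases "P = Q")
    case False
    have fin: "finite P" "finite Q" "P \<noteq> {}" "Q \<noteq> {}"
      using assms(2)[OF PQ(1)] assms(2)[OF PQ(2)] by (auto intro: card_ge_0_finite)
    have "P \<inter> Q = {}" using assms(1) PQ False by (auto simp: disjoint_def)
    moreover have "Min P \<in> P" "Max P \<in> P" "Min Q \<in> Q" "Max Q \<in> Q" using fin by auto
    ultimately have "Min P \<noteq> Min Q" "Min P \<noteq> Max Q" "Max P \<noteq> Min Q" "Max P \<noteq> Max Q" by auto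
    then have *: "x(Min P := a, Max P := b, Min Q := c, Max Q := d)
        = x(Min Q := c, Max Q := d, Min P := a, Max P := b)" for x :: "nat \<Rightarrow> 'a mat" and a b c d
      by (auto simp: fun_eq_iff)
    show ?thesis
      unfolding contract_pair_def comp_def * by (intro ext sum.swap)
  qed simp
qed

lemma contract_empty: "contract B D {} f = f"
  by (simp add: contract_def)

lemma contract_insert:
  assumes "disjoint (insert P \<pi>)" "\<And>Q. Q \<in> insert P \<pi> \<Longrightarrow> card Q = 2" "finite \<pi>" "P \<notin> \<pi>"
  shows "contract B D (insert P \<pi>) f = contract_pair B D P (contract B D \<pi> f)"
proof -
  interpret Finite_Set.comp_fun_commute_on "insert P \<pi>" "contract_pair B D"
    by (rule contract_pair_commute[OF assms(1,2)])
  show ?thesis unfolding contract_def using assms(3,4) by (simp add: subset_insertI)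
qed

datatype letter = Plain nat | Star nat

primrec letter_index :: "letter \<Rightarrow> nat" where
  "letter_index (Plain i) = i"
| "letter_index (Star i) = i"

primrec letter_val :: "(nat \<Rightarrow> 'a mat) \<Rightarrow> letter \<Rightarrow> 'a mat" where
  "letter_val x (Plain i) = x i"
| "letter_val x (Star i) = transpose_mat (x i)"

definition word_val :: "nat \<Rightarrow> (nat \<Rightarrow> 'a::comm_ring_1 mat) \<Rightarrow> letter list \<Rightarrow> 'a mat" where
  "word_val d x w = foldr (\<lambda>l M. letter_val x l * M) w (1\<^sub>m d)"

type_synonym trace_expr = "letter list list"

definition trace_expr_over :: "nat set \<Rightarrow> trace_expr \<Rightarrow> bool" where
  "trace_expr_over I T \<longleftrightarrow> (\<forall>w\<in>set T. w \<noteq> [] \<and> letter_index ` set w \<subseteq> I)"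

definition trace_expr_val :: "nat \<Rightarrow> (nat \<Rightarrow> 'a::comm_ring_1 mat) \<Rightarrow> trace_expr \<Rightarrow> 'a" where
  "trace_expr_val d x T = (\<Prod>w\<leftarrow>T. mtrace (word_val d x w))"

lemma vectorspace_sp_space: "vectorspace class_ring (sp_space n :: ('a::field, 'a mat) module)"
proof -
  let ?M = "module_mat TYPE('a) (2 * n) (2 * n)"
  interpret V: vectorspace class_ring ?M by (rule matrix_vs)
  have j: "sp_form n \<in> carrier_mat (2 * n) (2 * n)"
    by (auto simp: sp_form_def mult_2)
  have swap: "(A + B) + (C + D) = (A + C) + (B + D)"
    if "A \<in> carrier_mat (2 * n) (2 * n)" "B \<in> carrier_mat (2 * n) (2 * n)"
      "C \<in> carrier_mat (2 * n) (2 * n)" "D \<in> carrier_mat (2 * n) (2 * n)" for A B C D :: "'a mat"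
    using that by (intro eq_matI) auto
  have add: "X + Y \<in> sp n" if "X \<in> sp n" "Y \<in> sp n" for X Y :: "'a mat"
  proof -
    have c: "X \<in> carrier_mat (2 * n) (2 * n)" "Y \<in> carrier_mat (2 * n) (2 * n)"
      and e: "sp_form n * X + transpose_mat X * sp_form n = 0\<^sub>m (2 * n) (2 * n)"
        "sp_form n * Y + transpose_mat Y * sp_form n = 0\<^sub>m (2 * n) (2 * n)"
      using that by (auto simp: sp_def)
    have "sp_form n * (X + Y) + transpose_mat (X + Y) * sp_form n
        = (sp_form n * X + sp_form n * Y) + (transpose_mat X * sp_form n + transpose_mat Y * sp_form n)"
      unfolding transpose_add[OF c] mult_add_distrib_mat[OF j c]
        add_mult_distrib_mat[OF transpose_carrier_mat[THEN iffD2, OF c(1)] transpose_carrier_mat[THEN iffD2, OF c(2)] j] ..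
    also have "\<dots> = (sp_form n * X + transpose_mat X * sp_form n)
        + (sp_form n * Y + transpose_mat Y * sp_form n)"
      by (rule swap) (use c j in \<open>auto intro!: mult_carrier_mat[of _ "2 * n" "2 * n"]\<close>)
    finally show ?thesis using c by (simp add: sp_def e)
  qed
  have smult: "a \<cdot>\<^sub>m X \<in> sp n" if "X \<in> sp n" for a and X :: "'a mat"
  proof -
    have c: "X \<in> carrier_mat (2 * n) (2 * n)"
      and e: "sp_form n * X + transpose_mat X * sp_form n = 0\<^sub>m (2 * n) (2 * n)"
      using that by (auto simp: sp_def)
    have t: "transpose_mat (a \<cdot>\<^sub>m X) = a \<cdot>\<^sub>m transpose_mat X" by (intro eq_matI) auto
    have "sp_form n * (a \<cdot>\<^sub>m X) + transpose_mat (a \<cdot>\<^sub>m X) * sp_form n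
        = a \<cdot>\<^sub>m (sp_form n * X) + a \<cdot>\<^sub>m (transpose_mat X * sp_form n)"
      unfolding t mult_smult_distrib[OF j c]
        mult_smult_assoc_mat[OF transpose_carrier_mat[THEN iffD2, OF c] j] ..
    also have "\<dots> = a \<cdot>\<^sub>m (sp_form n * X + transpose_mat X * sp_form n)"
      using c j by (intro add_smult_distrib_left_mat[symmetric, of _ "2 * n" "2 * n"])
        (auto intro!: mult_carrier_mat[of _ "2 * n" "2 * n"])
    finally show ?thesis using c by (simp add: sp_def e)
  qed
  have zero: "(0\<^sub>m (2 * n) (2 * n) :: 'a mat) \<in> sp n"
    by (simp add: sp_def right_mult_zero_mat[OF j] left_mult_zero_mat[OF j])
  have "submodule class_ring (sp n) ?M"
    unfolding submodule_def
    using add smult zero V.module_axioms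
    by (auto simp: module_mat_simps sp_def)
  then have "VectorSpace.subspace class_ring (sp n) ?M"
    by (simp add: VectorSpace.subspace_def V.vectorspace_axioms)
  then have "vectorspace class_ring (V.vs (sp n))"
    by (rule V.subspace_is_vs)
  then show ?thesis by (simp add: sp_space_def)
qed

end

theory Submission
  imports Defs
begin

text \<open>
  Write \<open>J\<close> for the matrix of the symplectic form.  The map \<open>M \<mapsto> 1/2 (M + J M\<^sup>T J)\<close> is the
  projection of all matrices onto \<open>sp n\<close> that is self-adjoint for \<open>Tr (X Y)\<close>.  Expanding it in a
  basis \<open>\<alpha>\<close> with dual basis \<open>D \<alpha>\<close> gives \<open>\<Sum>\<alpha>. Tr (M D \<alpha>) \<alpha> = 1/2 (M + J M\<^sup>T J)\<close>, and from this
  one identity follow the two rules for contracting a dual pair: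
  a pair inside one trace, \<open>Tr (\<alpha> C (D \<alpha>) E)\<close>, sums to \<open>1/2 (Tr C Tr E - Tr (J C\<^sup>T J E))\<close>, and a pair
  spread over two traces, \<open>Tr (\<alpha> N) Tr (D \<alpha> M)\<close>, sums to \<open>1/2 (Tr (M N) + Tr (J M\<^sup>T J N))\<close>.

  If \<open>w\<close> is a word in elements of \<open>sp n\<close>, then \<open>J w\<^sup>T J\<close> is, up to sign, the same word read
  backwards, because \<open>J x\<^sup>T J = x\<close> on \<open>sp n\<close>.  Hence each contraction turns a product of traces
  of words in which every letter occurs once into a combination of two such products, with
  coefficients \<open>\<plusminus> 1/2\<close>; this is \<open>contract_trace_poly\<close>.  The only place where the size of the
  matrices enters is the trace of an empty word, \<open>Tr 1 = 2 n\<close>, which accounts for the polynomials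
  in \<open>n\<close> (\<open>trace_poly_val_to_exprs\<close>).

  The starting form has the same shape.  The trace of an operator \<open>A\<close> on \<open>sp n\<close> equals
  \<open>\<Sum>\<alpha>. Tr (A \<alpha> (D \<alpha>))\<close> (\<open>op_trace_eq_contraction\<close>), so \<open>Tr (ad x\<^sub>1 \<dots> ad x\<^sub>k)\<close> is itself the
  contraction along \<open>{0, k + 1}\<close> of \<open>Tr ([x\<^sub>1, [\<dots>, [x\<^sub>k, x\<^sub>0]]] x\<^sub>k\<^sub>+\<^sub>1)\<close>, a signed sum of traces of words.
  The theorem follows by induction on the number of contracted pairs.
\<close>

section \<open>Traces of square matrices\<close>

lemma mtrace_mult:
  assumes "A \<in> carrier_mat d d" "B \<in> carrier_mat d d"
  shows "mtrace (A * B) = (\<Sum>i<d. \<Sum>j<d. A $$ (i,j) * B $$ (j,i))"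
  using assms by (auto simp: mtrace_def scalar_prod_def atLeast0LessThan intro!: sum.cong)

lemma mtrace_comm:
  fixes A B :: "'a::comm_ring_1 mat"
  assumes "A \<in> carrier_mat d d" "B \<in> carrier_mat d d"
  shows "mtrace (A * B) = mtrace (B * A)"
  unfolding mtrace_mult[OF assms] mtrace_mult[OF assms(2,1)]
  by (subst sum.swap) (simp add: mult.commute)

lemma mtrace_add:
  assumes "A \<in> carrier_mat d d" "B \<in> carrier_mat d d"
  shows "mtrace (A + B) = mtrace A + mtrace B"
  using assms by (auto simp: mtrace_def sum.distrib)

lemma mtrace_minus:
  fixes A B :: "'a::comm_ring_1 mat"
  assumes "A \<in> carrier_mat d d" "B \<in> carrier_mat d d"
  shows "mtrace (A - B) = mtrace A - mtrace B"
  using assms by (auto simp: mtrace_def sum_subtractf)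

lemma mtrace_smult:
  assumes "A \<in> carrier_mat d d"
  shows "mtrace (c \<cdot>\<^sub>m A) = c * mtrace (A :: 'a::comm_ring_1 mat)"
  using assms by (auto simp: mtrace_def sum_distrib_left)

lemma mtrace_transpose: "A \<in> carrier_mat d d \<Longrightarrow> mtrace (transpose_mat A) = mtrace A"
  by (auto simp: mtrace_def)

lemma mtrace_one: "mtrace (1\<^sub>m d :: 'a::comm_ring_1 mat) = of_nat d"
  by (simp add: mtrace_def)

lemma square_mult_carrier [simp, intro]:
  "A \<in> carrier_mat d d \<Longrightarrow> B \<in> carrier_mat d d \<Longrightarrow> A * B \<in> carrier_mat d d"
  by (rule mult_carrier_mat)

lemma uminus_mult_mats:
  fixes A B :: "'a::comm_ring_1 mat"
  assumes "A \<in> carrier_mat d d" "B \<in> carrier_mat d d"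
  shows "- A * B = - (A * B)" "A * - B = - (A * B)"
  using assms by simp_all

section \<open>The symplectic form and its Lie algebra\<close>

lemma sp_form_entry:
  assumes "i < 2 * n" "j < 2 * n"
  shows "sp_form n $$ (i, j) = (if j = i + n then 1 else if i = j + n then - 1 else (0 :: 'a::ring_1))"
  using assms unfolding sp_form_def by (subst index_mat_four_block) auto

lemma sp_form_carrier [simp, intro]: "sp_form n \<in> carrier_mat (2 * n) (2 * n)"
  by (auto simp: sp_form_def mult_2)

lemma sp_form_dim [simp]: "dim_row (sp_form n) = 2 * n" "dim_col (sp_form n) = 2 * n"
  using carrier_matD[OF sp_form_carrier[of n]] by blast+

lemma transpose_sp_form: "transpose_mat (sp_form n) = (- sp_form n :: 'a :: ring_1 mat)"
  by (rule eq_matI) (auto simp: sp_form_entry)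

lemma uminus_zero_mat: "- 0\<^sub>m nr nc = (0\<^sub>m nr nc :: 'a :: ring_1 mat)"
  by (rule eq_matI) auto

lemma sp_form_square: "sp_form n * sp_form n = (- 1\<^sub>m (2 * n) :: 'a :: ring_1 mat)"
proof -
  have c: "0\<^sub>m n n \<in> carrier_mat n n" "1\<^sub>m n \<in> carrier_mat n n" "- 1\<^sub>m n \<in> carrier_mat n n" by simp_all
  have e: "0\<^sub>m n n * 0\<^sub>m n n + 1\<^sub>m n * - 1\<^sub>m n = (- 1\<^sub>m n :: 'a mat)"
    "0\<^sub>m n n * 1\<^sub>m n + 1\<^sub>m n * 0\<^sub>m n n = (0\<^sub>m n n :: 'a mat)"
    "- 1\<^sub>m n * 0\<^sub>m n n + 0\<^sub>m n n * - 1\<^sub>m n = (0\<^sub>m n n :: 'a mat)"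
    "- 1\<^sub>m n * 1\<^sub>m n + 0\<^sub>m n n * 0\<^sub>m n n = (- 1\<^sub>m n :: 'a mat)"
    using c by (simp_all add: uminus_zero_mat)
  have "sp_form n * sp_form n = four_block_mat (- 1\<^sub>m n) (0\<^sub>m n n) (0\<^sub>m n n) (- 1\<^sub>m n :: 'a mat)"
    unfolding sp_form_def mult_four_block_mat[OF c(1,2,3,1) c(1,2,3,1)] e ..
  also have "\<dots> = - 1\<^sub>m (2 * n)"
    by (rule eq_matI) (subst index_mat_four_block, auto)
  finally show ?thesis .
qed

lemma sp_carrier: "X \<in> sp n \<Longrightarrow> X \<in> carrier_mat (2 * n) (2 * n)"
  by (simp add: sp_def)

lemma transpose_mult_sp_form:
  fixes X :: "'a::comm_ring_1 mat"
  assumes "X \<in> sp n"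
  shows "transpose_mat X * sp_form n = - (sp_form n * X)"
proof -
  have c: "X \<in> carrier_mat (2 * n) (2 * n)" using assms by (rule sp_carrier)
  let ?P = "sp_form n * X" and ?Q = "transpose_mat X * sp_form n"
  have PQ: "?P \<in> carrier_mat (2 * n) (2 * n)" "?Q \<in> carrier_mat (2 * n) (2 * n)"
    using c by auto
  have e: "?P + ?Q = 0\<^sub>m (2 * n) (2 * n)"
    using assms by (simp add: sp_def)
  have "- ?P $$ (i, j) = ?Q $$ (i, j)" if "i < 2 * n" "j < 2 * n" for i j
    using arg_cong[OF e, of "\<lambda>M. M $$ (i, j)"] that PQ
    by (simp add: neg_eq_iff_add_eq_0 del: index_mult_mat)
  with PQ show ?thesis
    by (intro eq_matI) (auto simp del: index_mult_mat)
qed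

lemma sp_add: "X \<in> sp n \<Longrightarrow> Y \<in> sp n \<Longrightarrow> X + Y \<in> sp (n :: nat)" for X Y :: "'a::field mat"
proof -
  interpret S: vectorspace class_ring "sp_space n :: ('a, 'a mat) module"
    by (rule vectorspace_sp_space)
  show "X \<in> sp n \<Longrightarrow> Y \<in> sp n \<Longrightarrow> X + Y \<in> sp n"
    using S.a_closed[of X Y] by (simp add: sp_space_def module_mat_simps)
qed

lemma sp_smult: "X \<in> sp n \<Longrightarrow> c \<cdot>\<^sub>m X \<in> sp (n :: nat)" for X :: "'a::field mat"
proof -
  interpret S: vectorspace class_ring "sp_space n :: ('a, 'a mat) module"
    by (rule vectorspace_sp_space)
  show "X \<in> sp n \<Longrightarrow> c \<cdot>\<^sub>m X \<in> sp n"
    using S.smult_closed[of c X] by (simp add: sp_space_def module_mat_simps class_ring_simps)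
qed

lemma sp_zero: "0\<^sub>m (2 * n) (2 * n) \<in> (sp (n :: nat) :: 'a::field mat set)"
proof -
  interpret S: vectorspace class_ring "sp_space n :: ('a, 'a mat) module"
    by (rule vectorspace_sp_space)
  show ?thesis
    using S.zero_closed by (simp add: sp_space_def module_mat_simps)
qed

text \<open>The map \<open>M \<mapsto> J M\<^sup>T J\<close> is an involution of the space of matrices, and \<open>sp n\<close> consists of
  its fixed points.\<close>
lemma sp_form_sandwich_sp:
  fixes X :: "'a::comm_ring_1 mat"
  assumes "X \<in> sp n"
  shows "sp_form n * transpose_mat X * sp_form n = X"
proof -
  have c: "X \<in> carrier_mat (2 * n) (2 * n)" using assms by (rule sp_carrier)
  note J = sp_form_carrier[of n, where ?'a = 'a]
  have ct: "transpose_mat X \<in> carrier_mat (2 * n) (2 * n)" using c by simp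
  have "sp_form n * transpose_mat X * sp_form n = sp_form n * - (sp_form n * X)"
    unfolding assoc_mult_mat[OF J ct J] transpose_mult_sp_form[OF assms] ..
  also have "\<dots> = - (sp_form n * sp_form n * X)"
    unfolding assoc_mult_mat[OF J J c] using J c by (intro uminus_mult_mats) auto
  also have "\<dots> = X"
    unfolding sp_form_square using c by simp
  finally show ?thesis .
qed

text \<open>Moving \<open>J\<close> past two transposed elements of \<open>sp n\<close> costs two signs, which cancel; this is
  why the commutator stays in \<open>sp n\<close>, although in general the product does not.\<close>
lemma transpose_prod_mult_sp_form:
  fixes X Y :: "'a::comm_ring_1 mat"
  assumes X: "X \<in> sp n" and Y: "Y \<in> sp n"
  shows "transpose_mat (X * Y) * sp_form n = sp_form n * (Y * X)"
proof -
  let ?d = "2 * n" and ?J = "sp_form n :: 'a mat"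
  note J = sp_form_carrier[of n, where ?'a = 'a]
  note c = sp_carrier[OF X] sp_carrier[OF Y]
  have ct: "transpose_mat X \<in> carrier_mat ?d ?d" "transpose_mat Y \<in> carrier_mat ?d ?d"
    using c by auto
  have "transpose_mat (X * Y) * ?J = transpose_mat Y * (transpose_mat X * ?J)"
    unfolding transpose_mult[OF c] by (rule assoc_mult_mat[OF ct(2,1) J])
  also have "\<dots> = - (transpose_mat Y * (?J * X))"
    unfolding transpose_mult_sp_form[OF X] by (rule uminus_mult_mats(2)[OF ct(2) square_mult_carrier[OF J c(1)]])
  also have "transpose_mat Y * (?J * X) = transpose_mat Y * ?J * X"
    by (rule assoc_mult_mat[OF ct(2) J c(1), symmetric])
  also have "\<dots> = - (?J * Y * X)"
    unfolding transpose_mult_sp_form[OF Y] by (rule uminus_mult_mats(1)[OF square_mult_carrier[OF J c(2)] c(1)])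
  also have "?J * Y * X = ?J * (Y * X)"
    by (rule assoc_mult_mat[OF J c(2,1)])
  finally show ?thesis by simp
qed

lemma ad_sp:
  fixes X u :: "'a::comm_ring_1 mat"
  assumes X: "X \<in> sp n" and u: "u \<in> sp n"
  shows "ad X u \<in> sp n"
proof -
  let ?d = "2 * n" and ?J = "sp_form n :: 'a mat"
  note J = sp_form_carrier[of n, where ?'a = 'a]
  have c: "X * u \<in> carrier_mat ?d ?d" "u * X \<in> carrier_mat ?d ?d"
    using sp_carrier[OF X] sp_carrier[OF u] by auto
  have t: "transpose_mat (X * u) \<in> carrier_mat ?d ?d" "transpose_mat (u * X) \<in> carrier_mat ?d ?d"
    using c by auto
  have cancel: "(P - Q) + (Q - P) = 0\<^sub>m ?d ?d"
    if "P \<in> carrier_mat ?d ?d" "Q \<in> carrier_mat ?d ?d" for P Q :: "'a mat"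
    using that by (intro eq_matI) auto
  have "?J * (X * u - u * X) + transpose_mat (X * u - u * X) * ?J
     = (?J * (X * u) - ?J * (u * X)) + (?J * (u * X) - ?J * (X * u))"
    unfolding mult_minus_distrib_mat[OF J c] transpose_minus[OF c] minus_mult_distrib_mat[OF t J]
      transpose_prod_mult_sp_form[OF X u] transpose_prod_mult_sp_form[OF u X] ..
  also have "\<dots> = 0\<^sub>m ?d ?d"
    by (rule cancel[OF square_mult_carrier[OF J c(1)] square_mult_carrier[OF J c(2)]])
  finally show ?thesis
    unfolding ad_def sp_def using minus_carrier_mat[OF c(2), of "X * u"] by blast
qed

section \<open>Coordinates with respect to a basis of the Lie algebra\<close>

text \<open>Needed because a basis is not required to be finite by definition: sums over an infinite set
  would be zero, so finiteness must come from the dimension of the ambient matrix space.\<close>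
lemma fin_dim_module_mat:
  "vectorspace.fin_dim class_ring (module_mat TYPE('a::field) nr nc)"
proof -
  interpret V: vectorspace class_ring "module_mat TYPE('a::field) nr nc" by (rule matrix_vs)
  \<comment> \<open>The matrix units.\<close>
  define E where "E = (\<lambda>(k, l). mat nr nc (\<lambda>ij. if ij = (k, l) then 1 else (0::'a)))"
  let ?G = "E ` ({..<nr} \<times> {..<nc})"
  have G: "?G \<subseteq> carrier (module_mat TYPE('a) nr nc)"
    by (auto simp: E_def module_mat_simps)
  interpret S: submodule class_ring "V.span ?G" "module_mat TYPE('a) nr nc"
    by (rule V.span_is_submodule[OF G])
  have part: "mat nr nc (\<lambda>ij. if ij \<in> K then A $$ ij else 0) \<in> V.span ?G"
    if "finite K" "K \<subseteq> {..<nr} \<times> {..<nc}" for K and A :: "'a mat"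
    using that
  proof (induction K)
    case empty
    have "mat nr nc (\<lambda>ij. if ij \<in> {} then A $$ ij else 0) = 0\<^sub>m nr nc" by (intro eq_matI) auto
    then show ?case using S.zero_closed by (simp add: module_mat_simps)
  next
    case (insert kl K)
    have "E kl \<in> V.span ?G" by (rule subsetD[OF V.in_own_span[OF G]]) (use insert in auto)
    then have "(A $$ kl) \<cdot>\<^sub>m E kl + mat nr nc (\<lambda>ij. if ij \<in> K then A $$ ij else 0) \<in> V.span ?G"
      using S.m_closed S.smult_closed insert by (simp add: module_mat_simps class_ring_simps)
    also have "(A $$ kl) \<cdot>\<^sub>m E kl + mat nr nc (\<lambda>ij. if ij \<in> K then A $$ ij else 0)
        = mat nr nc (\<lambda>ij. if ij \<in> insert kl K then A $$ ij else 0)"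
      using insert.hyps by (intro eq_matI) (cases kl, auto simp: E_def)
    finally show ?case .
  qed
  have "A \<in> V.span ?G" if "A \<in> carrier_mat nr nc" for A
  proof -
    have "mat nr nc (\<lambda>ij. if ij \<in> {..<nr} \<times> {..<nc} then A $$ ij else 0) = A"
      using that by (intro eq_matI) auto
    then show ?thesis using part[of "{..<nr} \<times> {..<nc}" A] by simp
  qed
  then have "carrier_mat nr nc \<subseteq> V.span ?G" by blast
  then have "V.span ?G = carrier (module_mat TYPE('a) nr nc)"
    using V.span_is_subset2[OF G] by (simp add: module_mat_simps set_eq_subset)
  moreover have "finite ?G" by simp
  ultimately show ?thesis unfolding V.fin_dim_def using G by blast
qed

lemma submodule_sp:
  "submodule class_ring (sp n) (module_mat TYPE('a::field) (2 * n) (2 * n))"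
proof -
  interpret V: vectorspace class_ring "module_mat TYPE('a::field) (2 * n) (2 * n)" by (rule matrix_vs)
  show ?thesis
    unfolding submodule_def using V.module_axioms
    by (auto simp: module_mat_simps sp_carrier sp_add sp_smult sp_zero)
qed

lemma sp_basis_finite:
  assumes "vectorspace.basis class_ring (sp_space n) (B :: 'a::field mat set)"
  shows "finite B" and "B \<subseteq> sp n"
proof -
  interpret V: vectorspace class_ring "module_mat TYPE('a::field) (2 * n) (2 * n)" by (rule matrix_vs)
  interpret S: vectorspace class_ring "sp_space n :: ('a, 'a mat) module"
    by (rule vectorspace_sp_space)
  have "B \<subseteq> carrier (sp_space n)" using assms by (simp add: S.basis_def)
  then show sub: "B \<subseteq> sp n" by (simp add: sp_space_def)
  have "\<not> S.lin_dep B" using assms by (simp add: S.basis_def)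
  then have "V.lin_indpt B"
    using V.span_li_not_depend(2)[OF sub submodule_sp] by (simp add: sp_space_def)
  moreover have "B \<subseteq> carrier (module_mat TYPE('a) (2 * n) (2 * n))"
    using sub by (auto simp: module_mat_simps sp_carrier)
  ultimately show "finite B" using V.fin_dim_li_fin[OF fin_dim_module_mat] by blast
qed

text \<open>Linear combinations in \<open>sp_space n\<close> are module sums with no syntax of their own; every use of them
  below passes through a scalar linear functional (a matrix entry or a trace).\<close>
lemma linear_lincomb_sp:
  assumes "finite A" "A \<subseteq> sp n"
    and add: "\<And>X Y. X \<in> sp n \<Longrightarrow> Y \<in> sp n \<Longrightarrow> \<phi> (X + Y) = \<phi> X + \<phi> Y"
    and smult: "\<And>c X. X \<in> sp n \<Longrightarrow> \<phi> (c \<cdot>\<^sub>m X) = c * \<phi> X"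
  shows "\<phi> (module.lincomb (sp_space n) c A) = (\<Sum>b\<in>A. c b * \<phi> (b :: 'a::field mat))"
  using assms(1,2)
proof (induction A)
  interpret S: vectorspace class_ring "sp_space n :: ('a, 'a mat) module"
    by (rule vectorspace_sp_space)
  case empty
  have "\<phi> (0 \<cdot>\<^sub>m 0\<^sub>m (2 * n) (2 * n)) = 0 * \<phi> (0\<^sub>m (2 * n) (2 * n))"
    using sp_zero by (rule smult)
  moreover have "0 \<cdot>\<^sub>m 0\<^sub>m (2 * n) (2 * n) = (0\<^sub>m (2 * n) (2 * n) :: 'a mat)"
    by (intro eq_matI) auto
  ultimately show ?case by (simp add: S.lincomb_def) (simp add: sp_space_def module_mat_simps)
next
  interpret S: vectorspace class_ring "sp_space n :: ('a, 'a mat) module"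
    by (rule vectorspace_sp_space)
  case (insert b A)
  have sub: "A \<subseteq> carrier (sp_space n)" "b \<in> carrier (sp_space n)"
    using insert.prems by (auto simp: sp_space_def)
  have "S.lincomb c (insert b A) = c b \<cdot>\<^sub>m b + S.lincomb c A"
    using S.lincomb_insert[OF insert.hyps(1) sub(1) _ insert.hyps(2) sub(2), of c]
    by (simp add: class_ring_simps) (simp add: sp_space_def module_mat_simps)
  moreover have "S.lincomb c A \<in> sp n"
    using S.lincomb_closed[OF sub(1), of c] by (simp add: class_ring_simps) (simp add: sp_space_def)
  ultimately show ?case
    using insert sub by (simp add: add smult sp_smult)
qed

lemma lincomb_sp_entry:
  assumes "finite A" "A \<subseteq> sp n" "i < 2 * n" "j < 2 * n"
  shows "module.lincomb (sp_space n) c A $$ (i, j) = (\<Sum>b\<in>A. c b * (b :: 'a::field mat) $$ (i, j))"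
  by (rule linear_lincomb_sp[OF assms(1,2)])
     (use assms(3,4) in \<open>auto dest!: sp_carrier\<close>)

text \<open>Justifies the choice in the definition of coordinates: an expansion exists.\<close>
lemma coords_sp:
  assumes "vectorspace.basis class_ring (sp_space n) (B :: 'a::field mat set)" "v \<in> sp n"
  shows "v = module.lincomb (sp_space n) (coords (sp_space n) B v) B"
proof -
  interpret S: vectorspace class_ring "sp_space n :: ('a, 'a mat) module"
    by (rule vectorspace_sp_space)
  have "v \<in> S.span B" using assms by (simp add: S.basis_def) (simp add: sp_space_def)
  moreover have "B \<subseteq> carrier (sp_space n)" using assms(1) by (simp add: S.basis_def)
  ultimately obtain c where "v = S.lincomb c B"
    using S.finite_span[OF sp_basis_finite(1)[OF assms(1)]] by auto
  then show ?thesis unfolding coords_def by (rule someI[where P = "\<lambda>c. v = S.lincomb c B"])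
qed

lemma coords_sp_unique:
  assumes B: "vectorspace.basis class_ring (sp_space n) (B :: 'a::field mat set)" and v: "v \<in> sp n"
    and e: "\<And>i j. i < 2 * n \<Longrightarrow> j < 2 * n \<Longrightarrow> v $$ (i, j) = (\<Sum>b\<in>B. c b * b $$ (i, j))"
    and b: "b \<in> B"
  shows "coords (sp_space n) B v b = c b"
proof -
  interpret S: vectorspace class_ring "sp_space n :: ('a, 'a mat) module"
    by (rule vectorspace_sp_space)
  note fin = sp_basis_finite[OF B]
  have sub: "B \<subseteq> carrier (sp_space n)" using B by (simp add: S.basis_def)
  have cl: "S.lincomb c B \<in> sp n"
    using S.lincomb_closed[OF sub, of c] by (simp add: class_ring_simps) (simp add: sp_space_def)
  have eq: "S.lincomb c B = v"
    by (rule eq_matI)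
       (use sp_carrier[OF v] sp_carrier[OF cl] in \<open>auto simp: e lincomb_sp_entry[OF fin]\<close>)
  let ?r = "\<lambda>c. restrict c B"
  have r: "S.lincomb (?r f) B = S.lincomb f B" for f
    by (rule S.lincomb_cong) (use sub in \<open>auto simp: class_ring_simps\<close>)
  have "\<exists>!a. a \<in> B \<rightarrow>\<^sub>E carrier class_ring \<and> S.lincomb a B = v"
    using S.basis_criterion[OF fin(1) sub] B v by (auto simp: sp_space_def)
  then have "?r c = ?r (coords (sp_space n) B v)"
    using r[of c] r[of "coords (sp_space n) B v"] eq coords_sp[OF B v]
    by (auto simp: class_ring_simps)
  from fun_cong[OF this, of b] show ?thesis using b by simp
qed

section \<open>The projection onto the Lie algebra\<close>

text \<open>The average of the identity and the involution \<open>M \<mapsto> J M\<^sup>T J\<close>, hence the projection onto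
  the fixed points of the latter.\<close>
definition sp_proj :: "nat \<Rightarrow> 'a::field mat \<Rightarrow> 'a mat" where
  "sp_proj n M = (1 / 2) \<cdot>\<^sub>m (M + sp_form n * transpose_mat M * sp_form n)"

lemma sp_proj_carrier [simp, intro]: "M \<in> carrier_mat (2 * n) (2 * n) \<Longrightarrow> sp_proj n M \<in> carrier_mat (2 * n) (2 * n)"
  unfolding sp_proj_def by (intro smult_carrier_mat add_carrier_mat square_mult_carrier) auto

lemma sp_proj_in_sp:
  assumes M: "M \<in> carrier_mat (2 * n) (2 * n)"
  shows "sp_proj n M \<in> (sp n :: 'a::field mat set)"
proof -
  let ?J = "sp_form n :: 'a mat"
  note J = sp_form_carrier[of n, where ?'a = 'a]
  have Mt: "transpose_mat M \<in> carrier_mat (2 * n) (2 * n)" using M by simp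
  let ?N = "M + ?J * transpose_mat M * ?J"
  have N: "?N \<in> carrier_mat (2 * n) (2 * n)" using M J by (intro add_carrier_mat square_mult_carrier) auto
  have 1: "?J * ?N = ?J * M - transpose_mat M * ?J"
  proof -
    have "?J * ?N = ?J * M + ?J * ?J * transpose_mat M * ?J"
      using M Mt J by (simp add: mult_add_distrib_mat[where nr = "2 * n" and n = "2 * n" and nc = "2 * n"]
         assoc_mult_mat[where n\<^sub>1 = "2 * n" and n\<^sub>2 = "2 * n" and n\<^sub>3 = "2 * n" and n\<^sub>4 = "2 * n"])
    also have "?J * ?J * transpose_mat M * ?J = - (transpose_mat M * ?J)"
      unfolding sp_form_square using Mt J by (simp add: uminus_mult_mats[where d = "2 * n"])
    finally show ?thesis by (simp only: minus_add_uminus_mat[OF square_mult_carrier[OF J M] square_mult_carrier[OF Mt J]])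
  qed
  have 2: "transpose_mat ?N * ?J = transpose_mat M * ?J - ?J * M"
  proof -
    have "transpose_mat (?J * transpose_mat M * ?J) = ?J * (M * ?J)"
      using M Mt J by (simp add: transpose_mult[of _ "2 * n" "2 * n" _ "2 * n"] transpose_sp_form)
    then have "transpose_mat ?N = transpose_mat M + ?J * (M * ?J)"
      by (simp only: transpose_add[OF M square_mult_carrier[OF square_mult_carrier[OF J Mt] J]] transpose_transpose)
    then have "transpose_mat ?N * ?J = transpose_mat M * ?J + ?J * M * (?J * ?J)"
      using M Mt J by (simp add: add_mult_distrib_mat[where nr = "2 * n" and n = "2 * n" and nc = "2 * n"]
         assoc_mult_mat[where n\<^sub>1 = "2 * n" and n\<^sub>2 = "2 * n" and n\<^sub>3 = "2 * n" and n\<^sub>4 = "2 * n"])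
    also have "?J * M * (?J * ?J) = - (?J * M)"
      unfolding sp_form_square using M J by simp
    finally show ?thesis by (simp only: minus_add_uminus_mat[OF square_mult_carrier[OF Mt J] square_mult_carrier[OF J M]])
  qed
  have "?J * ?N + transpose_mat ?N * ?J = 0\<^sub>m (2 * n) (2 * n)"
    unfolding 1 2 using M Mt J square_mult_carrier[OF J M] square_mult_carrier[OF Mt J]
    by (intro eq_matI) (simp_all del: index_mult_mat(1))
  then have "?N \<in> sp n" using N by (simp add: sp_def)
  then show ?thesis unfolding sp_proj_def by (rule sp_smult)
qed

text \<open>Transposing inside the trace moves the involution from \<open>M\<close> to \<open>Y\<close>, where it acts trivially.\<close>
lemma mtrace_sandwich:
  fixes M Y :: "'a::field mat"
  assumes M: "M \<in> carrier_mat (2 * n) (2 * n)" and Y: "Y \<in> sp n"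
  shows "mtrace (sp_form n * transpose_mat M * sp_form n * Y) = mtrace (M * Y)"
proof -
  let ?J = "sp_form n :: 'a mat"
  note J = sp_form_carrier[of n, where ?'a = 'a]
  note y = sp_carrier[OF Y]
  have Mt: "transpose_mat M \<in> carrier_mat (2 * n) (2 * n)" using M by simp
  have Yt: "transpose_mat Y \<in> carrier_mat (2 * n) (2 * n)" using y by simp
  have "mtrace (?J * transpose_mat M * ?J * Y)
      = mtrace (transpose_mat (?J * transpose_mat M * ?J * Y))"
    using y J Mt by (subst mtrace_transpose[of _ "2 * n"]) auto
  also have "transpose_mat (?J * transpose_mat M * ?J * Y) = (transpose_mat Y * ?J * M) * ?J"
    using M Mt J y Yt by (simp add: transpose_mult[of _ "2 * n" "2 * n" _ "2 * n"] transpose_sp_form uminus_mult_mats[where d = "2 * n"]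
         assoc_mult_mat[where n\<^sub>1 = "2 * n" and n\<^sub>2 = "2 * n" and n\<^sub>3 = "2 * n" and n\<^sub>4 = "2 * n"])
  also have "mtrace \<dots> = mtrace (?J * (transpose_mat Y * ?J * M))"
    using M J Yt by (intro mtrace_comm[of _ "2 * n"]) auto
  also have "?J * (transpose_mat Y * ?J * M) = (?J * transpose_mat Y * ?J) * M"
    using M J Yt by (simp add: 
         assoc_mult_mat[where n\<^sub>1 = "2 * n" and n\<^sub>2 = "2 * n" and n\<^sub>3 = "2 * n" and n\<^sub>4 = "2 * n"])
  also have "\<dots> = Y * M" unfolding sp_form_sandwich_sp[OF Y] ..
  also have "mtrace (Y * M) = mtrace (M * Y)"
    using M y by (rule mtrace_comm[rotated])
  finally show ?thesis .
qed

text \<open>The projection is self-adjoint for the trace form and fixes \<open>Y\<close>.\<close>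
lemma mtrace_sp_proj:
  fixes M Y :: "'a::field_char_0 mat"
  assumes M: "M \<in> carrier_mat (2 * n) (2 * n)" and Y: "Y \<in> sp n"
  shows "mtrace (sp_proj n M * Y) = mtrace (M * Y)"
proof -
  let ?S = "sp_form n * transpose_mat M * sp_form n"
  have S: "?S \<in> carrier_mat (2 * n) (2 * n)" using M by (intro square_mult_carrier) auto
  note y = sp_carrier[OF Y]
  have "mtrace (sp_proj n M * Y) = (1 / 2) * mtrace ((M + ?S) * Y)"
    unfolding sp_proj_def mult_smult_assoc_mat[OF add_carrier_mat[OF S] y, of _ M]
    by (rule mtrace_smult[OF square_mult_carrier[OF add_carrier_mat[OF S] y]])
  also have "(M + ?S) * Y = M * Y + ?S * Y"
    by (rule add_mult_distrib_mat[OF M S y])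
  also have "mtrace \<dots> = mtrace (M * Y) + mtrace (?S * Y)"
    by (rule mtrace_add[OF square_mult_carrier[OF M y] square_mult_carrier[OF S y]])
  finally show ?thesis unfolding mtrace_sandwich[OF M Y] by simp
qed

section \<open>Contracting a dual pair in traces of matrices\<close>

locale sp_dual_basis =
  fixes n :: nat and B :: "'a::field_char_0 mat set" and D :: "'a mat \<Rightarrow> 'a mat"
  assumes basis: "vectorspace.basis class_ring (sp_space n) B"
    and dual: "dual_basis n B D"
begin

lemma finite_B: "finite B" and B_sub: "B \<subseteq> sp n"
  using sp_basis_finite[OF basis] by blast+

lemma D_sp: "\<alpha> \<in> B \<Longrightarrow> D \<alpha> \<in> sp n"
  using dual by (auto simp: dual_basis_def)

lemma B_carrier: "\<alpha> \<in> B \<Longrightarrow> \<alpha> \<in> carrier_mat (2 * n) (2 * n)"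
  using B_sub sp_carrier by blast

lemma D_carrier: "\<alpha> \<in> B \<Longrightarrow> D \<alpha> \<in> carrier_mat (2 * n) (2 * n)"
  using D_sp sp_carrier by blast

lemma linear_mtrace_mult:
  assumes "Y \<in> carrier_mat (2 * n) (2 * n)"
  shows "mtrace (module.lincomb (sp_space n) c B * Y) = (\<Sum>b\<in>B. c b * mtrace (b * Y))"
proof (rule linear_lincomb_sp[OF finite_B B_sub])
  fix X Z :: "'a mat" and c
  assume X: "X \<in> sp n"
  note x = sp_carrier[OF X]
  show "mtrace (c \<cdot>\<^sub>m X * Y) = c * mtrace (X * Y)"
    unfolding mult_smult_assoc_mat[OF x assms]
    using x assms by (intro mtrace_smult[of _ "2 * n"] square_mult_carrier)
  assume Z: "Z \<in> sp n"
  note z = sp_carrier[OF Z]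
  show "mtrace ((X + Z) * Y) = mtrace (X * Y) + mtrace (Z * Y)"
    unfolding add_mult_distrib_mat[OF x z assms]
    using x z assms by (intro mtrace_add[of _ "2 * n"] square_mult_carrier)
qed

text \<open>Pairing the expansion of \<open>v\<close> with \<open>D b\<close> isolates the coordinate at \<open>b\<close>.\<close>
lemma coords_eq_mtrace_dual:
  assumes v: "v \<in> sp n" and b: "b \<in> B"
  shows "coords (sp_space n) B v b = mtrace (v * D b)"
proof -
  have "mtrace (v * D b) = (\<Sum>a\<in>B. coords (sp_space n) B v a * mtrace (a * D b))"
    by (subst coords_sp[OF basis v], rule linear_mtrace_mult[OF D_carrier[OF b]])
  also have "\<dots> = (\<Sum>a\<in>B. if a = b then coords (sp_space n) B v a else 0)"
    using dual b by (intro sum.cong) (auto simp: dual_basis_def)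
  also have "\<dots> = coords (sp_space n) B v b"
    using b finite_B by simp
  finally show ?thesis by simp
qed

lemma dual_expansion:
  assumes v: "v \<in> sp n" and ij: "i < 2 * n" "j < 2 * n"
  shows "v $$ (i, j) = (\<Sum>\<alpha>\<in>B. mtrace (v * D \<alpha>) * \<alpha> $$ (i, j))"
proof -
  have "v $$ (i, j) = (\<Sum>\<alpha>\<in>B. coords (sp_space n) B v \<alpha> * \<alpha> $$ (i, j))"
    by (subst coords_sp[OF basis v], rule lincomb_sp_entry[OF finite_B B_sub ij])
  then show ?thesis using coords_eq_mtrace_dual[OF v] by simp
qed

text \<open>The tensor \<open>\<Sum>\<alpha>. \<alpha> \<otimes> D \<alpha>\<close>, in coordinates: it is the kernel of the projection onto \<open>sp n\<close>,
  which shows that it does not depend on the basis.  Both contraction rules below are read off from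
  this formula.\<close>
lemma casimir_entry:
  assumes M: "M \<in> carrier_mat (2 * n) (2 * n)" and ij: "i < 2 * n" "j < 2 * n"
  shows "(\<Sum>\<alpha>\<in>B. mtrace (M * D \<alpha>) * \<alpha> $$ (i, j)) = sp_proj n M $$ (i, j)"
  unfolding dual_expansion[OF sp_proj_in_sp[OF M] ij]
  by (intro sum.cong refl) (simp add: mtrace_sp_proj[OF M] D_sp)

text \<open>By linearity of \<open>X \<mapsto> Tr (X N)\<close>, the sum is this functional applied to the projection of
  \<open>M\<close>.\<close>
lemma contract_two_traces:
  assumes M: "M \<in> carrier_mat (2 * n) (2 * n)" and N: "N \<in> carrier_mat (2 * n) (2 * n)"
  shows "(\<Sum>\<alpha>\<in>B. mtrace (\<alpha> * N) * mtrace (D \<alpha> * M))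
     = 1 / 2 * (mtrace (M * N) + mtrace (sp_form n * transpose_mat M * sp_form n * N))"
proof -
  let ?d = "2 * n"
  let ?S = "sp_form n * transpose_mat M * sp_form n"
  have S: "?S \<in> carrier_mat ?d ?d" using M by (intro square_mult_carrier) auto
  have "(\<Sum>\<alpha>\<in>B. mtrace (\<alpha> * N) * mtrace (D \<alpha> * M))
      = (\<Sum>\<alpha>\<in>B. \<Sum>i<?d. \<Sum>j<?d. (mtrace (M * D \<alpha>) * \<alpha> $$ (i, j)) * N $$ (j, i))"
    by (intro sum.cong refl)
       (simp add: mtrace_comm[OF D_carrier M] mtrace_mult[OF B_carrier N] sum_distrib_left
         sum_distrib_right ac_simps)
  also have "\<dots> = (\<Sum>i<?d. \<Sum>j<?d. (\<Sum>\<alpha>\<in>B. mtrace (M * D \<alpha>) * \<alpha> $$ (i, j)) * N $$ (j, i))"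
    unfolding sum_distrib_right
    by (subst sum.swap, intro sum.cong refl, subst sum.swap, rule refl)
  also have "\<dots> = (\<Sum>i<?d. \<Sum>j<?d. sp_proj n M $$ (i, j) * N $$ (j, i))"
    by (intro sum.cong refl) (simp add: casimir_entry[OF M])
  also have "\<dots> = mtrace (sp_proj n M * N)"
    by (rule mtrace_mult[symmetric]) (use M N in auto)
  also have "\<dots> = 1 / 2 * mtrace ((M + ?S) * N)"
    unfolding sp_proj_def mult_smult_assoc_mat[OF add_carrier_mat[OF S] N, of _ M]
    by (rule mtrace_smult[OF square_mult_carrier[OF add_carrier_mat[OF S] N]])
  also have "(M + ?S) * N = M * N + ?S * N"
    by (rule add_mult_distrib_mat[OF M S N])
  also have "mtrace \<dots> = mtrace (M * N) + mtrace (?S * N)"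
    by (rule mtrace_add[OF square_mult_carrier[OF M N] square_mult_carrier[OF S N]])
  finally show ?thesis .
qed

text \<open>For fixed entry \<open>(i, j)\<close> of \<open>\<alpha>\<close>, the cofactor of \<open>\<alpha> $$ (i, j)\<close> in the trace is linear in
  \<open>D \<alpha>\<close>, namely its trace against the rank one matrix made of column \<open>i\<close> of \<open>E\<close> and row \<open>j\<close> of
  \<open>C\<close>.  The projection of that matrix has two parts: the matrix itself, which separates the traces of
  \<open>C\<close> and \<open>E\<close>, and its image under the involution, which joins \<open>C\<^sup>T\<close> and \<open>E\<close> into one trace.\<close>
lemma contract_one_trace:
  assumes C: "C \<in> carrier_mat (2 * n) (2 * n)" and E: "E \<in> carrier_mat (2 * n) (2 * n)"
  shows "(\<Sum>\<alpha>\<in>B. mtrace (\<alpha> * (C * (D \<alpha> * E))))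
     = 1 / 2 * (mtrace C * mtrace E - mtrace (sp_form n * transpose_mat C * sp_form n * E))"
proof -
  let ?d = "2 * n"
  let ?J = "sp_form n :: 'a mat"
  note J = sp_form_carrier[of n, where ?'a = 'a]
  have Ct: "transpose_mat C \<in> carrier_mat ?d ?d" using C by simp
  \<comment> \<open>The rank one matrix whose trace against \<open>D \<alpha>\<close> is the \<open>(j, i)\<close> entry of \<open>C (D \<alpha>) E\<close>.\<close>
  define R where "R i j = mat ?d ?d (\<lambda>(l, k). E $$ (l, i) * C $$ (j, k))" for i j
  have R: "R i j \<in> carrier_mat ?d ?d" for i j by (simp add: R_def)
  have entry: "(C * (D \<alpha> * E)) $$ (j, i) = mtrace (R i j * D \<alpha>)"
    if "\<alpha> \<in> B" "i < ?d" "j < ?d" for \<alpha> i j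
  proof -
    have "(C * (D \<alpha> * E)) $$ (j, i) = (\<Sum>k<?d. \<Sum>l<?d. C $$ (j, k) * (D \<alpha> $$ (k, l) * E $$ (l, i)))"
      using that C E D_carrier[OF that(1)]
      by (auto simp: scalar_prod_def atLeast0LessThan sum_distrib_left intro!: sum.cong)
    also have "\<dots> = (\<Sum>l<?d. \<Sum>k<?d. R i j $$ (l, k) * D \<alpha> $$ (k, l))"
      by (subst sum.swap) (simp add: R_def ac_simps)
    also have "\<dots> = mtrace (R i j * D \<alpha>)"
      using R D_carrier[OF that(1)] by (rule mtrace_mult[symmetric])
    finally show ?thesis .
  qed
  have proj: "sp_proj n (R i j) $$ (i, j)
      = 1 / 2 * (E $$ (i, i) * C $$ (j, j) - (?J * transpose_mat C) $$ (i, j) * (?J * E) $$ (j, i))"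
    if "i < ?d" "j < ?d" for i j
  proof -
    have "(?J * transpose_mat (R i j) * ?J) $$ (i, j)
       = (\<Sum>l<?d. (\<Sum>k<?d. ?J $$ (i, k) * (E $$ (l, i) * C $$ (j, k))) * ?J $$ (l, j))"
      using that J by (auto simp: scalar_prod_def atLeast0LessThan R_def intro!: sum.cong)
    also have "\<dots> = (\<Sum>l<?d. (\<Sum>k<?d. ?J $$ (i, k) * C $$ (j, k)) * (transpose_mat ?J $$ (j, l) * E $$ (l, i)))"
      using that J by (intro sum.cong refl) (auto simp: sum_distrib_right sum_distrib_left ac_simps intro!: sum.cong)
    also have "\<dots> = (\<Sum>k<?d. ?J $$ (i, k) * C $$ (j, k)) * (\<Sum>l<?d. transpose_mat ?J $$ (j, l) * E $$ (l, i))"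
      by (simp add: sum_distrib_left)
    also have "(\<Sum>k<?d. ?J $$ (i, k) * C $$ (j, k)) = (?J * transpose_mat C) $$ (i, j)"
      using that J C by (auto simp: scalar_prod_def atLeast0LessThan intro!: sum.cong)
    also have "(\<Sum>l<?d. transpose_mat ?J $$ (j, l) * E $$ (l, i)) = - (?J * E) $$ (j, i)"
      unfolding transpose_sp_form sum_negf[symmetric]
      using that J E by (auto simp: scalar_prod_def atLeast0LessThan sum_negf intro!: sum.cong)
    finally have s: "(?J * transpose_mat (R i j) * ?J) $$ (i, j)
       = (?J * transpose_mat C) $$ (i, j) * (- (?J * E) $$ (j, i))" .
    have "(?J * transpose_mat (R i j) * ?J) \<in> carrier_mat ?d ?d"
      using R by (intro square_mult_carrier) auto
    then have "sp_proj n (R i j) $$ (i, j)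
       = 1 / 2 * (R i j $$ (i, j) + (?J * transpose_mat (R i j) * ?J) $$ (i, j))"
      unfolding sp_proj_def using that R[of i j] by (simp del: index_mult_mat(1))
    then show ?thesis unfolding s using that by (simp add: R_def)
  qed
  have "(\<Sum>\<alpha>\<in>B. mtrace (\<alpha> * (C * (D \<alpha> * E))))
     = (\<Sum>\<alpha>\<in>B. \<Sum>i<?d. \<Sum>j<?d. mtrace (R i j * D \<alpha>) * \<alpha> $$ (i, j))"
    using C E D_carrier
    by (intro sum.cong refl) (simp add: mtrace_mult[OF B_carrier] entry mult.commute del: index_mult_mat)
  also have "\<dots> = (\<Sum>i<?d. \<Sum>j<?d. \<Sum>\<alpha>\<in>B. mtrace (R i j * D \<alpha>) * \<alpha> $$ (i, j))"
    by (subst sum.swap, intro sum.cong refl, subst sum.swap, rule refl)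
  also have "\<dots> = (\<Sum>i<?d. \<Sum>j<?d. 1 / 2 * (E $$ (i, i) * C $$ (j, j)
       - (?J * transpose_mat C) $$ (i, j) * (?J * E) $$ (j, i)))"
    by (intro sum.cong refl) (simp add: casimir_entry[OF R] proj del: index_mult_mat)
  also have "\<dots> = 1 / 2 * ((\<Sum>i<?d. \<Sum>j<?d. E $$ (i, i) * C $$ (j, j))
       - (\<Sum>i<?d. \<Sum>j<?d. (?J * transpose_mat C) $$ (i, j) * (?J * E) $$ (j, i)))"
    by (simp add: sum_subtractf sum_divide_distrib[symmetric] del: index_mult_mat)
  also have "(\<Sum>i<?d. \<Sum>j<?d. E $$ (i, i) * C $$ (j, j)) = mtrace C * mtrace E"
    unfolding mult.commute[of "mtrace C"] using C E by (simp add: mtrace_def sum_product)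
  also have "(\<Sum>i<?d. \<Sum>j<?d. (?J * transpose_mat C) $$ (i, j) * (?J * E) $$ (j, i))
      = mtrace (?J * transpose_mat C * (?J * E))"
    by (rule mtrace_mult[symmetric]) (use J Ct E in auto)
  also have "?J * transpose_mat C * (?J * E) = ?J * transpose_mat C * ?J * E"
    by (rule assoc_mult_mat[symmetric]) (use J Ct E in auto)
  finally show ?thesis .
qed

text \<open>The operator trace is taken in an unspecified basis \<open>B0\<close>, unrelated to \<open>B\<close>.  Both sides equal the
  double sum over \<open>b \<in> B0\<close> and \<open>\<beta> \<in> B\<close> of \<open>Tr (A b (D \<beta>))\<close> times the coordinate of \<open>\<beta>\<close> at
  \<open>b\<close>: on the left by expanding \<open>A b\<close> in \<open>B\<close>, on the right by expanding \<open>\<beta>\<close> in \<open>B0\<close>.\<close>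
lemma op_trace_eq_contraction:
  assumes closed: "\<And>u. u \<in> sp n \<Longrightarrow> A u \<in> sp n"
    and add: "\<And>u v. u \<in> sp n \<Longrightarrow> v \<in> sp n \<Longrightarrow> A (u + v) = A u + A v"
    and smult: "\<And>c u. u \<in> sp n \<Longrightarrow> A (c \<cdot>\<^sub>m u) = c \<cdot>\<^sub>m A u"
  shows "op_trace (sp_space n) A = (\<Sum>\<alpha>\<in>B. mtrace (A \<alpha> * D \<alpha>))"
proof -
  define B0 :: "'a mat set" where "B0 = (SOME B. vectorspace.basis class_ring (sp_space n) B)"
  have B0: "vectorspace.basis class_ring (sp_space n) B0"
    unfolding B0_def using basis by (rule someI)
  note fin0 = sp_basis_finite[OF B0]
  let ?c = "coords (sp_space n) B0"
  have c: "?c (A b) b = (\<Sum>\<beta>\<in>B. mtrace (A b * D \<beta>) * ?c \<beta> b)" if b: "b \<in> B0" for b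
  proof (rule coords_sp_unique[OF B0 closed _ b, where c = "\<lambda>b'. \<Sum>\<beta>\<in>B. mtrace (A b * D \<beta>) * ?c \<beta> b'"])
    show "b \<in> sp n" using b fin0 by blast
    then have Ab: "A b \<in> sp n" by (rule closed)
    fix i j assume ij: "i < 2 * n" "j < 2 * n"
    have "A b $$ (i, j) = (\<Sum>\<beta>\<in>B. mtrace (A b * D \<beta>) * \<beta> $$ (i, j))"
      by (rule dual_expansion[OF Ab ij])
    also have "\<dots> = (\<Sum>\<beta>\<in>B. mtrace (A b * D \<beta>) * (\<Sum>b'\<in>B0. ?c \<beta> b' * b' $$ (i, j)))"
    proof (intro sum.cong refl)
      fix \<beta> assume "\<beta> \<in> B"
      then have "\<beta> \<in> sp n" using B_sub by blast
      from coords_sp[OF B0 this]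
      have "\<beta> $$ (i, j) = (\<Sum>b'\<in>B0. ?c \<beta> b' * b' $$ (i, j))"
        using lincomb_sp_entry[OF fin0 ij, of "?c \<beta>"] by metis
      then show "mtrace (A b * D \<beta>) * \<beta> $$ (i, j)
         = mtrace (A b * D \<beta>) * (\<Sum>b'\<in>B0. ?c \<beta> b' * b' $$ (i, j))" by simp
    qed
    also have "\<dots> = (\<Sum>b'\<in>B0. (\<Sum>\<beta>\<in>B. mtrace (A b * D \<beta>) * ?c \<beta> b') * b' $$ (i, j))"
      unfolding sum_distrib_left sum_distrib_right
      by (subst sum.swap) (simp add: ac_simps)
    finally show "A b $$ (i, j) = (\<Sum>b'\<in>B0. (\<Sum>\<beta>\<in>B. mtrace (A b * D \<beta>) * ?c \<beta> b') * b' $$ (i, j))" .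
  qed
  have "op_trace (sp_space n) A = (\<Sum>b\<in>B0. ?c (A b) b)"
    by (simp add: op_trace_def B0_def Let_def)
  also have "\<dots> = (\<Sum>b\<in>B0. \<Sum>\<beta>\<in>B. mtrace (A b * D \<beta>) * ?c \<beta> b)"
    using c by simp
  also have "\<dots> = (\<Sum>\<beta>\<in>B. \<Sum>b\<in>B0. ?c \<beta> b * mtrace (A b * D \<beta>))"
    by (subst sum.swap) (simp add: mult.commute)
  also have "\<dots> = (\<Sum>\<beta>\<in>B. mtrace (A \<beta> * D \<beta>))"
  proof (intro sum.cong refl)
    fix \<beta> assume \<beta>: "\<beta> \<in> B"
    then have \<beta>sp: "\<beta> \<in> sp n" using B_sub by blast
    note d = D_carrier[OF \<beta>]
    have "mtrace (A (module.lincomb (sp_space n) (?c \<beta>) B0) * D \<beta>)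
       = (\<Sum>b\<in>B0. ?c \<beta> b * mtrace (A b * D \<beta>))"
    proof (rule linear_lincomb_sp[OF fin0])
      fix X Z :: "'a mat" and c
      assume X: "X \<in> sp n"
      note x = sp_carrier[OF closed[OF X]]
      show "mtrace (A (c \<cdot>\<^sub>m X) * D \<beta>) = c * mtrace (A X * D \<beta>)"
        unfolding smult[OF X] mult_smult_assoc_mat[OF x d]
        using x d by (intro mtrace_smult[of _ "2 * n"] square_mult_carrier)
      assume Z: "Z \<in> sp n"
      note z = sp_carrier[OF closed[OF Z]]
      show "mtrace (A (X + Z) * D \<beta>) = mtrace (A X * D \<beta>) + mtrace (A Z * D \<beta>)"
        unfolding add[OF X Z] add_mult_distrib_mat[OF x z d]
        using x z d by (intro mtrace_add[of _ "2 * n"] square_mult_carrier)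
    qed
    then show "(\<Sum>b\<in>B0. ?c \<beta> b * mtrace (A b * D \<beta>)) = mtrace (A \<beta> * D \<beta>)"
      using coords_sp[OF B0 \<beta>sp] by simp
  qed
  finally show ?thesis .
qed

end

section \<open>Words in elements of the Lie algebra\<close>

text \<open>Words are lists of indices without transposed letters: since \<open>x\<^sup>T = J x J\<close> on \<open>sp n\<close>, transposition
  only ever shows up as reversal of a word and a sign.\<close>
definition word_mat :: "nat \<Rightarrow> (nat \<Rightarrow> 'a::comm_ring_1 mat) \<Rightarrow> nat list \<Rightarrow> 'a mat" where
  "word_mat d x w = foldr (\<lambda>i M. x i * M) w (1\<^sub>m d)"

lemma word_mat_simps [simp]:
  "word_mat d x [] = 1\<^sub>m d" "word_mat d x (i # w) = x i * word_mat d x w"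
  by (simp_all add: word_mat_def)

lemma word_val_Plain: "word_val d x (map Plain w) = word_mat d x w"
  by (induction w) (simp_all add: word_val_def)

lemma word_mat_carrier:
  "(\<And>i. i \<in> set w \<Longrightarrow> x i \<in> carrier_mat d d) \<Longrightarrow> word_mat d x w \<in> carrier_mat d d"
  by (induction w) auto

lemma word_mat_append:
  assumes "\<And>i. i \<in> set (v @ w) \<Longrightarrow> x i \<in> carrier_mat d d"
  shows "word_mat d x (v @ w) = word_mat d x v * word_mat d x w"
  using assms
proof (induction v)
  case Nil
  then show ?case using word_mat_carrier[of w x d] by simp
next
  case (Cons i v)
  have "x i \<in> carrier_mat d d" "word_mat d x v \<in> carrier_mat d d" "word_mat d x w \<in> carrier_mat d d"
    using Cons.prems by (auto intro!: word_mat_carrier)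
  then show ?case using Cons by (simp add: assoc_mult_mat[of _ d d _ d _ d])
qed

lemma word_mat_cong: "(\<And>i. i \<in> set w \<Longrightarrow> x i = y i) \<Longrightarrow> word_mat d x w = word_mat d y w"
  by (induction w) auto

lemma mtrace_word_rotate:
  assumes "\<And>i. i \<in> set (v @ w) \<Longrightarrow> x i \<in> carrier_mat d d"
  shows "mtrace (word_mat d x (v @ w)) = mtrace (word_mat d x (w @ v))"
proof -
  have c: "word_mat d x v \<in> carrier_mat d d" "word_mat d x w \<in> carrier_mat d d"
    using assms by (auto intro!: word_mat_carrier)
  show ?thesis
    using assms mtrace_comm[OF c] by (subst (1 2) word_mat_append) auto
qed

lemma word_mat_snoc:
  assumes "\<And>j. j \<in> set w \<Longrightarrow> x j \<in> carrier_mat d d" "x i \<in> carrier_mat d d"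
  shows "word_mat d x (w @ [i]) = word_mat d x w * x i"
  using assms by (subst word_mat_append) auto

text \<open>Inserting \<open>J J = - 1\<close> between consecutive letters of \<open>J w\<^sup>T J\<close> turns each \<open>J x\<^sup>T J\<close> into \<open>x\<close>;
  the sign counts the insertions, with exponent \<open>length w - 1\<close>, written \<open>Suc (length w)\<close> so
  that the empty word is covered too.\<close>
lemma sp_form_sandwich_word:
  fixes x :: "nat \<Rightarrow> 'a::field mat"
  assumes "\<And>i. i \<in> set w \<Longrightarrow> x i \<in> sp n"
  shows "sp_form n * transpose_mat (word_mat (2 * n) x w) * sp_form n
    = (- 1) ^ Suc (length w) \<cdot>\<^sub>m word_mat (2 * n) x (rev w)"
  using assms
proof (induction w)
  case Nil
  show ?case by (simp add: sp_form_square right_mult_one_mat[OF sp_form_carrier]) (rule eq_matI, auto)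
next
  case (Cons i w)
  let ?d = "2 * n" and ?J = "sp_form n :: 'a mat"
  note J = sp_form_carrier[of n, where ?'a = 'a]
  have xi: "x i \<in> sp n" using Cons.prems by simp
  note c = sp_carrier[OF xi]
  have ct: "transpose_mat (x i) \<in> carrier_mat ?d ?d" using c by simp
  have W: "word_mat ?d x w \<in> carrier_mat ?d ?d" "word_mat ?d x (rev w) \<in> carrier_mat ?d ?d"
    using Cons.prems by (auto intro!: word_mat_carrier intro: sp_carrier)
  have Wt: "transpose_mat (word_mat ?d x w) \<in> carrier_mat ?d ?d" using W by simp
  have "?J * transpose_mat (word_mat ?d x (i # w)) * ?J
     = ?J * (transpose_mat (word_mat ?d x w) * transpose_mat (x i)) * ?J"
    by (simp add: transpose_mult[OF c W(1)])
  also have "\<dots> = ?J * transpose_mat (word_mat ?d x w) * (transpose_mat (x i) * ?J)"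
    using J ct Wt by (simp add: assoc_mult_mat[where n\<^sub>1 = ?d and n\<^sub>2 = ?d and n\<^sub>3 = ?d and n\<^sub>4 = ?d])
  also have "\<dots> = ?J * transpose_mat (word_mat ?d x w) * (- (?J * x i))"
    unfolding transpose_mult_sp_form[OF xi] ..
  also have "\<dots> = - (?J * transpose_mat (word_mat ?d x w) * ?J * x i)"
    using J c Wt by (simp add: uminus_mult_mats[where d = ?d]
       assoc_mult_mat[where n\<^sub>1 = ?d and n\<^sub>2 = ?d and n\<^sub>3 = ?d and n\<^sub>4 = ?d])
  also have "?J * transpose_mat (word_mat ?d x w) * ?J
     = (- 1) ^ Suc (length w) \<cdot>\<^sub>m word_mat ?d x (rev w)"
    using Cons by simp
  also have "- ((- 1) ^ Suc (length w) \<cdot>\<^sub>m word_mat ?d x (rev w) * x i)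
     = (- 1) ^ Suc (length (i # w)) \<cdot>\<^sub>m (word_mat ?d x (rev w) * x i)"
    unfolding mult_smult_assoc_mat[OF W(2) c] by (rule eq_matI) auto
  also have "word_mat ?d x (rev w) * x i = word_mat ?d x (rev (i # w))"
    using Cons.prems c by (simp, subst word_mat_snoc) (auto intro: sp_carrier)
  finally show ?case .
qed

section \<open>Contracting multilinear trace polynomials\<close>

definition monomial_val :: "nat \<Rightarrow> (nat \<Rightarrow> 'a::comm_ring_1 mat) \<Rightarrow> nat list list \<Rightarrow> 'a" where
  "monomial_val d x T = (\<Prod>w\<leftarrow>T. mtrace (word_mat d x w))"

type_synonym 'a trace_poly = "('a poly \<times> nat list list) list"

definition trace_poly_val :: "nat \<Rightarrow> (nat \<Rightarrow> 'a::comm_ring_1 mat) \<Rightarrow> 'a trace_poly \<Rightarrow> 'a" where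
  "trace_poly_val n x L = (\<Sum>(p, T)\<leftarrow>L. poly p (of_nat n) * monomial_val (2 * n) x T)"

text \<open>Every letter of \<open>I\<close> occurs exactly once in each monomial.  This invariant makes contraction
  possible letter by letter: changing \<open>x a\<close> and \<open>x b\<close> leaves the rest of a monomial alone.\<close>
definition multilinear_in :: "nat set \<Rightarrow> 'a trace_poly \<Rightarrow> bool" where
  "multilinear_in I L \<longleftrightarrow> (\<forall>(p, T)\<in>set L. distinct (concat T) \<and> set (concat T) = I)"

lemma multilinear_in_simps:
  "multilinear_in I (L @ L') \<longleftrightarrow> multilinear_in I L \<and> multilinear_in I L'"
  "multilinear_in I (map (\<lambda>(r, T). (p * r, T)) L) \<longleftrightarrow> multilinear_in I L"
  unfolding multilinear_in_def by (simp_all add: ball_Un split_def)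

lemma monomial_val_simps [simp]:
  "monomial_val d x [] = 1"
  "monomial_val d x (w # T) = mtrace (word_mat d x w) * monomial_val d x T"
  "monomial_val d x (S @ T) = monomial_val d x S * monomial_val d x T"
  by (simp_all add: monomial_val_def)

lemma monomial_val_cong:
  "(\<And>i. i \<in> set (concat T) \<Longrightarrow> x i = y i) \<Longrightarrow> monomial_val d x T = monomial_val d y T"
  unfolding monomial_val_def by (intro arg_cong[of _ _ prod_list] map_cong refl arg_cong[of _ _ mtrace] word_mat_cong) auto

lemma trace_poly_val_simps [simp]:
  "trace_poly_val n x [] = 0"
  "trace_poly_val n x ((p, T) # L) = poly p (of_nat n) * monomial_val (2 * n) x T + trace_poly_val n x L"
  "trace_poly_val n x (L @ L') = trace_poly_val n x L + trace_poly_val n x L'"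
  by (simp_all add: trace_poly_val_def)

text \<open>Traces are invariant under rotation of words and their product is commutative, so a given letter
  can be brought to the very front.\<close>
lemma monomial_isolate:
  assumes "a \<in> set (concat T)"
  shows "\<exists>w T'. mset (concat T) = mset (concat ((a # w) # T')) \<and>
    (\<forall>d (x :: nat \<Rightarrow> 'a::comm_ring_1 mat). (\<forall>i\<in>set (concat T). x i \<in> carrier_mat d d)
       \<longrightarrow> monomial_val d x T = monomial_val d x ((a # w) # T'))"
proof -
  from assms obtain u where u: "u \<in> set T" "a \<in> set u" by auto
  then obtain v w S T' where e: "T = S @ u # T'" "u = v @ a # w" by (meson split_list)
  have "monomial_val d x T = monomial_val d x ((a # w @ v) # S @ T')"
    if "\<forall>i\<in>set (concat T). x i \<in> carrier_mat d d" for d and x :: "nat \<Rightarrow> 'a mat"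
  proof -
    have "mtrace (word_mat d x (v @ a # w)) = mtrace (word_mat d x ((a # w) @ v))"
      using that by (intro mtrace_word_rotate) (auto simp: e)
    then show ?thesis by (simp add: e ac_simps)
  qed
  moreover have "mset (concat T) = mset (concat ((a # w @ v) # S @ T'))" by (simp add: e)
  ultimately show ?thesis by blast
qed

context sp_dual_basis
begin

text \<open>The two contraction rules for words: the involution reverses the word between the pair.\<close>
lemma contract_same_word:
  assumes "\<And>i. i \<in> set (c @ d) \<Longrightarrow> x i \<in> sp n" and "a \<noteq> b" "a \<notin> set (c @ d)" "b \<notin> set (c @ d)"
  shows "(\<Sum>\<alpha>\<in>B. mtrace (word_mat (2 * n) (x(a := \<alpha>, b := D \<alpha>)) (a # c @ b # d)))
    = 1 / 2 * (mtrace (word_mat (2 * n) x c) * mtrace (word_mat (2 * n) x d))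
      + (- 1) ^ length c / 2 * mtrace (word_mat (2 * n) x (rev c @ d))"
proof -
  let ?W = "word_mat (2 * n)"
  have cd: "i \<in> set (c @ d) \<Longrightarrow> x i \<in> carrier_mat (2 * n) (2 * n)" for i
    using assms(1) sp_carrier by blast
  have C: "?W x c \<in> carrier_mat (2 * n) (2 * n)" "?W x (rev c) \<in> carrier_mat (2 * n) (2 * n)"
    and E: "?W x d \<in> carrier_mat (2 * n) (2 * n)"
    using cd by (auto intro!: word_mat_carrier)
  have "?W (x(a := \<alpha>, b := D \<alpha>)) (a # c @ b # d) = \<alpha> * (?W x c * (D \<alpha> * ?W x d))"
    if "\<alpha> \<in> B" for \<alpha>
  proof -
    have 1: "?W (x(a := \<alpha>, b := D \<alpha>)) c = ?W x c" "?W (x(a := \<alpha>, b := D \<alpha>)) d = ?W x d"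
      using assms by (auto intro!: word_mat_cong)
    have "?W (x(a := \<alpha>, b := D \<alpha>)) (c @ b # d)
       = ?W (x(a := \<alpha>, b := D \<alpha>)) c * ?W (x(a := \<alpha>, b := D \<alpha>)) (b # d)"
      using cd D_carrier[OF that] B_carrier[OF that] by (intro word_mat_append) auto
    then show ?thesis using assms(2) by (simp add: 1)
  qed
  then have "(\<Sum>\<alpha>\<in>B. mtrace (?W (x(a := \<alpha>, b := D \<alpha>)) (a # c @ b # d)))
     = (\<Sum>\<alpha>\<in>B. mtrace (\<alpha> * (?W x c * (D \<alpha> * ?W x d))))"
    by (intro sum.cong refl) simp
  also have "\<dots> = 1 / 2 * (mtrace (?W x c) * mtrace (?W x d)
      - mtrace ((- 1) ^ Suc (length c) \<cdot>\<^sub>m ?W x (rev c) * ?W x d))"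
    unfolding contract_one_trace[OF C(1) E]
    using assms(1) by (subst sp_form_sandwich_word) auto
  also have "mtrace ((- 1) ^ Suc (length c) \<cdot>\<^sub>m ?W x (rev c) * ?W x d)
     = (- 1) ^ Suc (length c) * mtrace (?W x (rev c @ d))"
    unfolding mult_smult_assoc_mat[OF C(2) E] mtrace_smult[OF square_mult_carrier[OF C(2) E]]
    using cd by (subst word_mat_append) auto
  also have "1 / 2 * (mtrace (?W x c) * mtrace (?W x d) - (- 1) ^ Suc (length c) * mtrace (?W x (rev c @ d)))
     = 1 / 2 * (mtrace (?W x c) * mtrace (?W x d)) + (- 1) ^ length c / 2 * mtrace (?W x (rev c @ d))"
    by (simp add: field_simps)
  finally show ?thesis .
qed

lemma contract_two_words:
  assumes "\<And>i. i \<in> set (v @ w) \<Longrightarrow> x i \<in> sp n" and "a \<noteq> b" "a \<notin> set (v @ w)" "b \<notin> set (v @ w)"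
  shows "(\<Sum>\<alpha>\<in>B. mtrace (word_mat (2 * n) (x(a := \<alpha>, b := D \<alpha>)) (a # w))
       * mtrace (word_mat (2 * n) (x(a := \<alpha>, b := D \<alpha>)) (b # v)))
    = 1 / 2 * mtrace (word_mat (2 * n) x (v @ w))
      - (- 1) ^ length v / 2 * mtrace (word_mat (2 * n) x (rev v @ w))"
proof -
  let ?W = "word_mat (2 * n)"
  have vw: "i \<in> set (v @ w) \<Longrightarrow> x i \<in> carrier_mat (2 * n) (2 * n)" for i
    using assms(1) sp_carrier by blast
  have V: "?W x v \<in> carrier_mat (2 * n) (2 * n)" "?W x (rev v) \<in> carrier_mat (2 * n) (2 * n)"
    and W: "?W x w \<in> carrier_mat (2 * n) (2 * n)"
    using vw by (auto intro!: word_mat_carrier)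
  have "?W (x(a := \<alpha>, b := D \<alpha>)) v = ?W x v" "?W (x(a := \<alpha>, b := D \<alpha>)) w = ?W x w" for \<alpha>
    using assms by (auto intro!: word_mat_cong)
  then have "(\<Sum>\<alpha>\<in>B. mtrace (?W (x(a := \<alpha>, b := D \<alpha>)) (a # w)) * mtrace (?W (x(a := \<alpha>, b := D \<alpha>)) (b # v)))
     = (\<Sum>\<alpha>\<in>B. mtrace (\<alpha> * ?W x w) * mtrace (D \<alpha> * ?W x v))"
    using assms(2) by simp
  also have "\<dots> = 1 / 2 * (mtrace (?W x v * ?W x w)
      + mtrace ((- 1) ^ Suc (length v) \<cdot>\<^sub>m ?W x (rev v) * ?W x w))"
    unfolding contract_two_traces[OF V(1) W]
    using assms(1) by (subst sp_form_sandwich_word) auto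
  also have "mtrace ((- 1) ^ Suc (length v) \<cdot>\<^sub>m ?W x (rev v) * ?W x w)
     = (- 1) ^ Suc (length v) * mtrace (?W x (rev v @ w))"
    unfolding mult_smult_assoc_mat[OF V(2) W] mtrace_smult[OF square_mult_carrier[OF V(2) W]]
    using vw by (subst word_mat_append) auto
  also have "?W x v * ?W x w = ?W x (v @ w)"
    using vw by (subst word_mat_append) auto
  also have "1 / 2 * (mtrace (?W x (v @ w)) + (- 1) ^ Suc (length v) * mtrace (?W x (rev v @ w)))
     = 1 / 2 * mtrace (?W x (v @ w)) - (- 1) ^ length v / 2 * mtrace (?W x (rev v @ w))"
    by (simp add: field_simps)
  finally show ?thesis .
qed

end

text \<open>The list \<open>L\<close> is chosen before \<open>n\<close>, the basis and the matrices; this uniformity is what makes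
  the final coefficients depend on the combinatorics only.\<close>
lemma contract_monomial:
  fixes T :: "nat list list"
  assumes dist: "distinct (concat T)" and a: "a \<in> set (concat T)" and b: "b \<in> set (concat T)" and ab: "a \<noteq> b"
  shows "\<exists>L :: 'a::field_char_0 trace_poly. multilinear_in (set (concat T) - {a, b}) L \<and>
    (\<forall>n B D x. sp_dual_basis n B D \<longrightarrow> (\<forall>i\<in>set (concat T) - {a, b}. x i \<in> sp n) \<longrightarrow>
       (\<Sum>\<alpha>\<in>B. monomial_val (2 * n) (x(a := \<alpha>, b := D \<alpha>)) T) = trace_poly_val n x L)"
proof -
  have carr: "(x(a := \<alpha>, b := D \<alpha>)) i \<in> carrier_mat (2 * n) (2 * n)"
    if "sp_dual_basis n B D" "\<alpha> \<in> B" "\<forall>i\<in>set (concat T) - {a, b}. x i \<in> sp n" "i \<in> set (concat T)"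
    for n B D \<alpha> i and x :: "nat \<Rightarrow> 'a mat"
    using that sp_dual_basis.B_carrier[OF that(1,2)] sp_dual_basis.D_carrier[OF that(1,2)]
    by (auto intro: sp_carrier)
  obtain w T' where ms: "mset (concat T) = mset (concat ((a # w) # T'))"
    and val: "\<forall>d (x :: nat \<Rightarrow> 'a mat). (\<forall>i\<in>set (concat T). x i \<in> carrier_mat d d)
       \<longrightarrow> monomial_val d x T = monomial_val d x ((a # w) # T')"
    using monomial_isolate[OF a, where ?'a = 'a] by blast
  have dist': "distinct (a # w @ concat T')"
    using dist mset_eq_imp_distinct_iff[OF ms] by simp
  have set': "set (concat T) = insert a (set w \<union> set (concat T'))"
    using mset_eq_setD[OF ms] by simp
  show ?thesis
  proof (cases "b \<in> set w")
    case True
    then obtain c d where w: "w = c @ b # d" by (meson split_list)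
    \<comment> \<open>The pair cuts the cyclic word into two arcs; they become separate traces or are glued reversed.\<close>
    let ?L = "[([:1 / 2:], c # d # T'), ([:(- 1) ^ length c / 2:], (rev c @ d) # T')] :: 'a trace_poly"
    have I: "set (concat T) - {a, b} = set (c @ d) \<union> set (concat T')"
      using dist' unfolding set' w by auto
    have "multilinear_in (set (concat T) - {a, b}) ?L"
      using dist' unfolding I multilinear_in_def by (auto simp: w)
    moreover have "(\<Sum>\<alpha>\<in>B. monomial_val (2 * n) (x(a := \<alpha>, b := D \<alpha>)) T) = trace_poly_val n x ?L"
      if db: "sp_dual_basis n B D" and x: "\<forall>i\<in>set (concat T) - {a, b}. x i \<in> sp n"
      for n B D and x :: "nat \<Rightarrow> 'a mat"
    proof -
      interpret sp_dual_basis n B D by (rule db)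
      have "(\<Sum>\<alpha>\<in>B. monomial_val (2 * n) (x(a := \<alpha>, b := D \<alpha>)) T)
         = (\<Sum>\<alpha>\<in>B. mtrace (word_mat (2 * n) (x(a := \<alpha>, b := D \<alpha>)) (a # c @ b # d))
              * monomial_val (2 * n) x T')"
      proof (intro sum.cong refl)
        fix \<alpha> assume \<alpha>: "\<alpha> \<in> B"
        have "monomial_val (2 * n) (x(a := \<alpha>, b := D \<alpha>)) T' = monomial_val (2 * n) x T'"
          using dist' by (intro monomial_val_cong) (auto simp: w)
        then show "monomial_val (2 * n) (x(a := \<alpha>, b := D \<alpha>)) T
          = mtrace (word_mat (2 * n) (x(a := \<alpha>, b := D \<alpha>)) (a # c @ b # d)) * monomial_val (2 * n) x T'"
          using val[rule_format, OF carr[OF db \<alpha> x]] by (simp only: monomial_val_simps w)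
      qed
      also have "\<dots> = trace_poly_val n x ?L"
        unfolding sum_distrib_right[symmetric]
        by (subst contract_same_word) (use x[unfolded I] dist' in \<open>auto simp: w algebra_simps\<close>)
      finally show ?thesis .
    qed
    ultimately show ?thesis by blast
  next
    case False
    then have b': "b \<in> set (concat T')" using b ab unfolding set' by blast
    obtain v T'' where ms2: "mset (concat T') = mset (concat ((b # v) # T''))"
      and val2: "\<forall>d (x :: nat \<Rightarrow> 'a mat). (\<forall>i\<in>set (concat T'). x i \<in> carrier_mat d d)
       \<longrightarrow> monomial_val d x T' = monomial_val d x ((b # v) # T'')"
      using monomial_isolate[OF b', where ?'a = 'a] by blast
    have set2: "set (concat T') = insert b (set v \<union> set (concat T''))"
      using mset_eq_setD[OF ms2] by simp
    have "mset (a # w @ concat T') = mset (a # w @ b # v @ concat T'')" using ms2 by simp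
    from mset_eq_imp_distinct_iff[OF this] have dist2: "distinct (a # w @ b # v @ concat T'')"
      using dist' by blast
    \<comment> \<open>The pair joins two cyclic words into one, in the two possible orientations.\<close>
    let ?L = "[([:1 / 2:], (v @ w) # T''), ([:- ((- 1) ^ length v / 2):], (rev v @ w) # T'')] :: 'a trace_poly"
    have I: "set (concat T) - {a, b} = set (v @ w) \<union> set (concat T'')"
      using dist2 unfolding set' set2 by auto
    have "multilinear_in (set (concat T) - {a, b}) ?L"
      using dist2 unfolding I multilinear_in_def by auto
    moreover have "(\<Sum>\<alpha>\<in>B. monomial_val (2 * n) (x(a := \<alpha>, b := D \<alpha>)) T) = trace_poly_val n x ?L"
      if db: "sp_dual_basis n B D" and x: "\<forall>i\<in>set (concat T) - {a, b}. x i \<in> sp n"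
      for n B D and x :: "nat \<Rightarrow> 'a mat"
    proof -
      interpret sp_dual_basis n B D by (rule db)
      have "(\<Sum>\<alpha>\<in>B. monomial_val (2 * n) (x(a := \<alpha>, b := D \<alpha>)) T)
         = (\<Sum>\<alpha>\<in>B. mtrace (word_mat (2 * n) (x(a := \<alpha>, b := D \<alpha>)) (a # w))
              * mtrace (word_mat (2 * n) (x(a := \<alpha>, b := D \<alpha>)) (b # v)) * monomial_val (2 * n) x T'')"
      proof (intro sum.cong refl)
        fix \<alpha> assume \<alpha>: "\<alpha> \<in> B"
        have 1: "monomial_val (2 * n) (x(a := \<alpha>, b := D \<alpha>)) T'' = monomial_val (2 * n) x T''"
          using dist2 by (intro monomial_val_cong) auto
        have "monomial_val (2 * n) (x(a := \<alpha>, b := D \<alpha>)) T'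
          = monomial_val (2 * n) (x(a := \<alpha>, b := D \<alpha>)) ((b # v) # T'')"
          by (rule val2[rule_format], rule carr[OF db \<alpha> x], unfold set', blast)
        then show "monomial_val (2 * n) (x(a := \<alpha>, b := D \<alpha>)) T
          = mtrace (word_mat (2 * n) (x(a := \<alpha>, b := D \<alpha>)) (a # w))
              * mtrace (word_mat (2 * n) (x(a := \<alpha>, b := D \<alpha>)) (b # v)) * monomial_val (2 * n) x T''"
          using val[rule_format, OF carr[OF db \<alpha> x]] by (simp only: monomial_val_simps 1 mult.assoc)
      qed
      also have "\<dots> = trace_poly_val n x ?L"
        unfolding sum_distrib_right[symmetric]
        by (subst contract_two_words) (use x[unfolded I] dist2 in \<open>auto simp: algebra_simps\<close>)
      finally show ?thesis .
    qed
    ultimately show ?thesis by blast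
  qed
qed

lemma contract_trace_poly:
  fixes L :: "'a::field_char_0 trace_poly"
  assumes "multilinear_in I L" and a: "a \<in> I" and b: "b \<in> I" and ab: "a \<noteq> b"
  shows "\<exists>L' :: 'a trace_poly. multilinear_in (I - {a, b}) L' \<and>
    (\<forall>n B D x. sp_dual_basis n B D \<longrightarrow> (\<forall>i\<in>I - {a, b}. x i \<in> sp n) \<longrightarrow>
       (\<Sum>\<alpha>\<in>B. trace_poly_val n (x(a := \<alpha>, b := D \<alpha>)) L) = trace_poly_val n x L')"
  using assms(1)
proof (induction L)
  case Nil
  show ?case by (intro exI[of _ "[]"]) (simp add: multilinear_in_def)
next
  case (Cons pT L)
  obtain p T where pT: "pT = (p, T)" by (cases pT)
  have T: "distinct (concat T)" "set (concat T) = I" and "multilinear_in I L"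
    using Cons.prems by (auto simp: multilinear_in_def pT)
  with Cons.IH obtain L2 :: "'a trace_poly" where L2: "multilinear_in (I - {a, b}) L2"
    "\<And>n B D x. sp_dual_basis n B D \<Longrightarrow> \<forall>i\<in>I - {a, b}. x i \<in> sp n \<Longrightarrow>
       (\<Sum>\<alpha>\<in>B. trace_poly_val n (x(a := \<alpha>, b := D \<alpha>)) L) = trace_poly_val n x L2"
    by blast
  obtain L1 :: "'a trace_poly" where L1: "multilinear_in (I - {a, b}) L1"
    "\<And>n B D x. sp_dual_basis n B D \<Longrightarrow> \<forall>i\<in>I - {a, b}. x i \<in> sp n \<Longrightarrow>
       (\<Sum>\<alpha>\<in>B. monomial_val (2 * n) (x(a := \<alpha>, b := D \<alpha>)) T) = trace_poly_val n x L1"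
    using contract_monomial[OF T(1), of a b] a b ab unfolding T(2) by blast
  let ?M = "map (\<lambda>(r, S). (p * r, S)) L1"
  have M: "trace_poly_val n x ?M = poly p (of_nat n) * trace_poly_val n x L1" for n x
    by (induction L1) (auto simp: algebra_simps)
  have "multilinear_in (I - {a, b}) (?M @ L2)"
    using L1(1) L2(1) by (simp add: multilinear_in_simps)
  moreover have "(\<Sum>\<alpha>\<in>B. trace_poly_val n (x(a := \<alpha>, b := D \<alpha>)) (pT # L)) = trace_poly_val n x (?M @ L2)"
    if "sp_dual_basis n B D" "\<forall>i\<in>I - {a, b}. x i \<in> sp n" for n B D x
    using L1(2)[OF that] L2(2)[OF that]
    by (simp add: pT M sum.distrib sum_distrib_left[symmetric])
  ultimately show ?case by blast
qed

section \<open>Traces of products of adjoint operators\<close>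

text \<open>The letter \<open>0\<close> marks the argument of the operator.  Each commutator puts its letter either in front
  of or behind the words obtained so far.\<close>
primrec ad_words :: "nat list \<Rightarrow> ('a::comm_ring_1 \<times> nat list) list" where
  "ad_words [] = [(1, [0])]"
| "ad_words (i # js) = map (\<lambda>(c, w). (c, i # w)) (ad_words js) @ map (\<lambda>(c, w). (- c, w @ [i])) (ad_words js)"

lemma mset_ad_words: "(c, w) \<in> set (ad_words js) \<Longrightarrow> mset w = mset (0 # js)"
  by (induction js arbitrary: c w) auto

abbreviation ad_comp :: "(nat \<Rightarrow> 'a::comm_ring_1 mat) \<Rightarrow> nat list \<Rightarrow> 'a mat \<Rightarrow> 'a mat" where
  "ad_comp x js \<equiv> foldr (\<lambda>i g. ad (x i) \<circ> g) js id"

lemma ad_carrier: "X \<in> carrier_mat d d \<Longrightarrow> u \<in> carrier_mat d d \<Longrightarrow> ad X u \<in> carrier_mat d d"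
  unfolding ad_def by (intro minus_carrier_mat square_mult_carrier)

lemma ad_comp_carrier:
  assumes "\<And>j. j \<in> set js \<Longrightarrow> x j \<in> carrier_mat d d" "u \<in> carrier_mat d d"
  shows "ad_comp x js u \<in> carrier_mat d d"
  using assms by (induction js) (auto intro!: ad_carrier)

lemma ad_comp_sp:
  fixes x :: "nat \<Rightarrow> 'a::field mat"
  assumes "\<And>j. j \<in> set js \<Longrightarrow> x j \<in> sp n" "u \<in> sp n"
  shows "ad_comp x js u \<in> sp n"
  using assms by (induction js) (auto intro: ad_sp)

lemma ad_add:
  fixes X :: "'a::comm_ring_1 mat"
  assumes "X \<in> carrier_mat d d" "u \<in> carrier_mat d d" "v \<in> carrier_mat d d"
  shows "ad X (u + v) = ad X u + ad X v"
proof -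
  have "(P + Q) - (R + S) = (P - R) + (Q - S)"
    if "P \<in> carrier_mat d d" "Q \<in> carrier_mat d d" "R \<in> carrier_mat d d" "S \<in> carrier_mat d d"
    for P Q R S :: "'a mat"
    using that by (intro eq_matI) auto
  from this[OF square_mult_carrier[OF assms(1,2)] square_mult_carrier[OF assms(1,3)] square_mult_carrier[OF assms(2,1)] square_mult_carrier[OF assms(3,1)]]
  show ?thesis
    unfolding ad_def mult_add_distrib_mat[OF assms] add_mult_distrib_mat[OF assms(2,3,1)] .
qed

lemma ad_smult:
  fixes X :: "'a::comm_ring_1 mat"
  assumes "X \<in> carrier_mat d d" "u \<in> carrier_mat d d"
  shows "ad X (r \<cdot>\<^sub>m u) = r \<cdot>\<^sub>m ad X u"
proof -
  have "r \<cdot>\<^sub>m P - r \<cdot>\<^sub>m Q = r \<cdot>\<^sub>m (P - Q)"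
    if "P \<in> carrier_mat d d" "Q \<in> carrier_mat d d" for P Q :: "'a mat"
    using that by (intro eq_matI) (auto simp: algebra_simps)
  from this[OF square_mult_carrier[OF assms] square_mult_carrier[OF assms(2,1)]] show ?thesis
    unfolding ad_def mult_smult_distrib[OF assms] mult_smult_assoc_mat[OF assms(2,1)] .
qed

lemma ad_comp_Cons: "ad_comp x (i # js) u = ad (x i) (ad_comp x js u)"
  by simp

lemma ad_comp_add:
  fixes x :: "nat \<Rightarrow> 'a::comm_ring_1 mat"
  assumes "\<And>j. j \<in> set js \<Longrightarrow> x j \<in> carrier_mat d d" "u \<in> carrier_mat d d" "v \<in> carrier_mat d d"
  shows "ad_comp x js (u + v) = ad_comp x js u + ad_comp x js v"
  using assms(1)
proof (induction js)
  case (Cons i js)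
  have c: "x i \<in> carrier_mat d d" "ad_comp x js u \<in> carrier_mat d d" "ad_comp x js v \<in> carrier_mat d d"
    using Cons.prems assms(2,3) by (auto intro!: ad_comp_carrier)
  have IH: "ad_comp x js (u + v) = ad_comp x js u + ad_comp x js v"
    using Cons.prems by (intro Cons.IH) auto
  show ?case unfolding ad_comp_Cons IH ad_add[OF c] ..
qed simp

lemma ad_comp_smult:
  fixes x :: "nat \<Rightarrow> 'a::comm_ring_1 mat"
  assumes "\<And>j. j \<in> set js \<Longrightarrow> x j \<in> carrier_mat d d" "u \<in> carrier_mat d d"
  shows "ad_comp x js (r \<cdot>\<^sub>m u) = r \<cdot>\<^sub>m ad_comp x js u"
  using assms(1)
proof (induction js)
  case (Cons i js)
  have c: "x i \<in> carrier_mat d d" "ad_comp x js u \<in> carrier_mat d d"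
    using Cons.prems assms(2) by (auto intro!: ad_comp_carrier)
  have IH: "ad_comp x js (r \<cdot>\<^sub>m u) = r \<cdot>\<^sub>m ad_comp x js u"
    using Cons.prems by (intro Cons.IH) auto
  show ?case unfolding ad_comp_Cons IH ad_smult[OF c] ..
qed simp

lemma signed_sum_list:
  "(\<Sum>(c, w)\<leftarrow>map (\<lambda>(c, w). (c, f w)) L @ map (\<lambda>(c, w). (- c, g w)) L. c * h w)
    = (\<Sum>(c, w)\<leftarrow>L. c * h (f w)) - (\<Sum>(c, w)\<leftarrow>L. c * (h (g w) :: 'a::comm_ring_1))"
  by (induction L) (auto simp: algebra_simps)

lemma mtrace_ad_comp:
  assumes "\<And>j. j \<in> set (0 # js) \<Longrightarrow> x j \<in> carrier_mat d d" "Z \<in> carrier_mat d d"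
  shows "mtrace (ad_comp x js (x 0) * Z) = (\<Sum>(c, w)\<leftarrow>ad_words js. c * mtrace (word_mat d x w * Z))"
  using assms
proof (induction js arbitrary: Z)
  case Nil
  then show ?case by simp
next
  case (Cons i js)
  let ?A = "ad_comp x js (x 0)"
  have xi: "x i \<in> carrier_mat d d" and Z: "Z \<in> carrier_mat d d" using Cons.prems by auto
  have A: "?A \<in> carrier_mat d d" using Cons.prems by (intro ad_comp_carrier) auto
  have w: "word_mat d x w \<in> carrier_mat d d \<and> word_mat d x (w @ [i]) = word_mat d x w * x i"
    if "(c, w) \<in> set (ad_words js)" for c :: 'a and w
  proof -
    have "set w = set (0 # js)" using mset_ad_words[OF that] by (rule mset_eq_setD)
    then have "\<And>j. j \<in> set w \<Longrightarrow> x j \<in> carrier_mat d d" using Cons.prems by auto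
    then show ?thesis using xi by (simp add: word_mat_carrier word_mat_snoc)
  qed
  have left: "mtrace (x i * ?A * Z) = (\<Sum>(c, w)\<leftarrow>ad_words js. c * mtrace (word_mat d x (i # w) * Z))"
  proof -
    have "mtrace (x i * ?A * Z) = mtrace (?A * (Z * x i))"
      unfolding assoc_mult_mat[OF xi A Z] mtrace_comm[OF xi square_mult_carrier[OF A Z]] assoc_mult_mat[OF A Z xi] ..
    also have "\<dots> = (\<Sum>(c, w)\<leftarrow>ad_words js. c * mtrace (word_mat d x w * (Z * x i)))"
      by (rule Cons.IH) (use Cons.prems in auto)
    also have "\<dots> = (\<Sum>(c, w)\<leftarrow>ad_words js. c * mtrace (word_mat d x (i # w) * Z))"
    proof (intro arg_cong[of _ _ sum_list] map_cong refl, clarify)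
      fix c :: 'a and w assume cw: "(c, w) \<in> set (ad_words js)"
      note W = conjunct1[OF w[OF cw]]
      show "c * mtrace (word_mat d x w * (Z * x i)) = c * mtrace (word_mat d x (i # w) * Z)"
        unfolding word_mat_simps assoc_mult_mat[OF xi W Z] mtrace_comm[OF xi square_mult_carrier[OF W Z]] assoc_mult_mat[OF W Z xi] ..
    qed
    finally show ?thesis .
  qed
  have right: "mtrace (?A * x i * Z) = (\<Sum>(c, w)\<leftarrow>ad_words js. c * mtrace (word_mat d x (w @ [i]) * Z))"
  proof -
    have "mtrace (?A * x i * Z) = mtrace (?A * (x i * Z))"
      unfolding assoc_mult_mat[OF A xi Z] ..
    also have "\<dots> = (\<Sum>(c, w)\<leftarrow>ad_words js. c * mtrace (word_mat d x w * (x i * Z)))"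
      by (rule Cons.IH) (use Cons.prems in auto)
    also have "\<dots> = (\<Sum>(c, w)\<leftarrow>ad_words js. c * mtrace (word_mat d x (w @ [i]) * Z))"
    proof (intro arg_cong[of _ _ sum_list] map_cong refl, clarify)
      fix c :: 'a and w assume cw: "(c, w) \<in> set (ad_words js)"
      note W = w[OF cw]
      show "c * mtrace (word_mat d x w * (x i * Z)) = c * mtrace (word_mat d x (w @ [i]) * Z)"
        unfolding conjunct2[OF W] assoc_mult_mat[OF conjunct1[OF W] xi Z] ..
    qed
    finally show ?thesis .
  qed
  have "ad_comp x (i # js) (x 0) * Z = (x i * ?A - ?A * x i) * Z"
    by (simp add: ad_def)
  also have "\<dots> = x i * ?A * Z - ?A * x i * Z"
    by (rule minus_mult_distrib_mat[OF square_mult_carrier[OF xi A] square_mult_carrier[OF A xi] Z])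
  finally have "mtrace (ad_comp x (i # js) (x 0) * Z) = mtrace (x i * ?A * Z) - mtrace (?A * x i * Z)"
    using mtrace_minus[OF square_mult_carrier[OF square_mult_carrier[OF xi A] Z] square_mult_carrier[OF square_mult_carrier[OF A xi] Z]] by (simp only:)
  then show ?case
    unfolding left right ad_words.simps signed_sum_list .
qed

text \<open>The indices \<open>0\<close> and \<open>k + 1\<close> lie outside \<open>{1..k}\<close> and serve as the slots for the basis element
  and its dual, so that the operator trace becomes one more contraction.\<close>
lemma ad_trace_form_trace_poly:
  "\<exists>L :: 'a::field_char_0 trace_poly. multilinear_in {1..k} L \<and>
    (\<forall>n (B :: 'a mat set) D x. sp_dual_basis n B D \<longrightarrow> (\<forall>i\<in>{1..k}. x i \<in> sp n) \<longrightarrow>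
       ad_trace_form n k x = trace_poly_val n x L)"
proof -
  let ?js = "[1..<Suc k]"
  define L :: "'a trace_poly" where "L = map (\<lambda>(c, w). ([:c:], [w @ [Suc k]])) (ad_words ?js)"
  have "distinct (w @ [Suc k]) \<and> set (w @ [Suc k]) = {0..Suc k}" if "(c, w) \<in> set (ad_words ?js)"
    for c :: 'a and w
  proof -
    have m: "mset w = mset (0 # ?js)" by (rule mset_ad_words[OF that])
    have "distinct w" using mset_eq_imp_distinct_iff[OF m] by (simp del: upt_Suc)
    moreover have "set w = {0..k}" unfolding mset_eq_setD[OF m] list.set set_upt by auto
    ultimately show ?thesis by auto
  qed
  then have "multilinear_in {0..Suc k} L"
    unfolding multilinear_in_def L_def set_map ball_simps split_def fst_conv snd_conv by force
  then have "multilinear_in {0..Suc k} L" "0 \<in> {0..Suc k}" "Suc k \<in> {0..Suc k}" "0 \<noteq> Suc k"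
    by simp_all
  from contract_trace_poly[OF this]
  obtain L' :: "'a trace_poly" where L': "multilinear_in ({0..Suc k} - {0, Suc k}) L'"
    and contr: "\<forall>n B D x. sp_dual_basis n B D \<longrightarrow> (\<forall>i\<in>{0..Suc k} - {0, Suc k}. x i \<in> sp n) \<longrightarrow>
       (\<Sum>\<alpha>\<in>B. trace_poly_val n (x(0 := \<alpha>, Suc k := D \<alpha>)) L) = trace_poly_val n x L'"
    by blast
  have I: "{0..Suc k} - {0, Suc k} = {1..k}" by auto
  have "ad_trace_form n k x = trace_poly_val n x L'"
    if db: "sp_dual_basis n B D" and x: "\<forall>i\<in>{1..k}. x i \<in> sp n" for n and B :: "'a mat set" and D and x :: "nat \<Rightarrow> 'a mat"
  proof -
    interpret sp_dual_basis n B D by (rule db)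
    have js: "j \<in> set ?js \<Longrightarrow> x j \<in> sp n" for j using x by auto
    have js': "j \<in> set ?js \<Longrightarrow> x j \<in> carrier_mat (2 * n) (2 * n)" for j using js sp_carrier by blast
    have "ad_trace_form n k x = (\<Sum>\<alpha>\<in>B. mtrace (ad_comp x ?js \<alpha> * D \<alpha>))"
      unfolding ad_trace_form_def
    proof (rule op_trace_eq_contraction)
      fix u v :: "'a mat" and c
      assume u: "u \<in> sp n"
      show "ad_comp x ?js u \<in> sp n" by (rule ad_comp_sp[OF js u])
      show "ad_comp x ?js (c \<cdot>\<^sub>m u) = c \<cdot>\<^sub>m ad_comp x ?js u"
        by (rule ad_comp_smult[OF js' sp_carrier[OF u]])
      assume v: "v \<in> sp n"
      show "ad_comp x ?js (u + v) = ad_comp x ?js u + ad_comp x ?js v"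
        by (rule ad_comp_add[OF js' sp_carrier[OF u] sp_carrier[OF v]])
    qed
    also have "\<dots> = (\<Sum>\<alpha>\<in>B. trace_poly_val n (x(0 := \<alpha>, Suc k := D \<alpha>)) L)"
    proof (intro sum.cong refl)
      fix \<alpha> assume \<alpha>: "\<alpha> \<in> B"
      let ?x = "x(0 := \<alpha>, Suc k := D \<alpha>)"
      have cx: "?x j \<in> carrier_mat (2 * n) (2 * n)" if "j \<in> {0..Suc k}" for j
        using that js'[of j] B_carrier[OF \<alpha>] D_carrier[OF \<alpha>]
        by (cases "j = Suc k") (auto simp del: upt_Suc)
      have same: "ad_comp x ?js = ad_comp ?x ?js"
        by (rule foldr_cong) auto
      have "?x 0 = \<alpha>" by simp
      then have "mtrace (ad_comp x ?js \<alpha> * D \<alpha>) = mtrace (ad_comp ?x ?js (?x 0) * D \<alpha>)"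
        unfolding same by (simp only:)
      also have "\<dots> = (\<Sum>(c, w)\<leftarrow>ad_words ?js. c * mtrace (word_mat (2 * n) ?x w * D \<alpha>))"
      proof (rule mtrace_ad_comp[OF _ D_carrier[OF \<alpha>]])
        fix j assume "j \<in> set (0 # ?js)"
        then have "j \<in> {0..Suc k}" unfolding list.set set_upt by auto
        then show "?x j \<in> carrier_mat (2 * n) (2 * n)" by (rule cx)
      qed
      also have "\<dots> = (\<Sum>(c, w)\<leftarrow>ad_words ?js. poly [:c:] (of_nat n) * monomial_val (2 * n) ?x [w @ [Suc k]])"
      proof (intro arg_cong[of _ _ sum_list] map_cong refl, clarify)
        fix c :: 'a and w assume cw: "(c, w) \<in> set (ad_words ?js)"
        have "set w = {0..k}"
          unfolding mset_eq_setD[OF mset_ad_words[OF cw]] list.set set_upt by auto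
        then have "word_mat (2 * n) ?x (w @ [Suc k]) = word_mat (2 * n) ?x w * ?x (Suc k)"
          by (intro word_mat_snoc cx) auto
        then show "c * mtrace (word_mat (2 * n) ?x w * D \<alpha>)
          = poly [:c:] (of_nat n) * monomial_val (2 * n) ?x [w @ [Suc k]]"
          by simp
      qed
      also have "\<dots> = trace_poly_val n ?x L"
        by (simp add: trace_poly_val_def L_def o_def split_def)
      finally show "mtrace (ad_comp x ?js \<alpha> * D \<alpha>) = trace_poly_val n ?x L" .
    qed
    also have "\<dots> = trace_poly_val n x L'"
      by (rule contr[unfolded I, rule_format, OF db]) (use x in blast)
    finally show ?thesis .
  qed
  with L'[unfolded I] show ?thesis by (intro exI[of _ L']) simp
qed

text \<open>An induction over the pairs: the substituted basis elements and their duals lie in \<open>sp n\<close>, so the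
  formula for the smaller set of pairs applies to each summand of the next contraction.\<close>
lemma contract_ad_trace_form:
  assumes "finite \<pi>" and "\<And>P. P \<in> \<pi> \<Longrightarrow> P \<subseteq> {1..k} \<and> card P = 2" and "disjoint \<pi>"
  shows "\<exists>L :: 'a::field_char_0 trace_poly. multilinear_in ({1..k} - \<Union>\<pi>) L \<and>
    (\<forall>n B D x. sp_dual_basis n B D \<longrightarrow> (\<forall>i\<in>{1..k} - \<Union>\<pi>. x i \<in> sp n) \<longrightarrow>
       contract B D \<pi> (ad_trace_form n k) x = trace_poly_val n x L)"
  using assms
proof (induction \<pi>)
  case empty
  show ?case using ad_trace_form_trace_poly[of k] by (simp add: contract_empty)
next
  case (insert P \<pi>)
  have dis: "disjoint \<pi>" using insert.prems(2) unfolding disjoint_def by blast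
  have pairs: "Q \<subseteq> {1..k} \<and> card Q = 2" if "Q \<in> \<pi>" for Q using that insert.prems(1) by blast
  obtain L :: "'a trace_poly" where L: "multilinear_in ({1..k} - \<Union>\<pi>) L"
    and val: "\<forall>n B D x. sp_dual_basis n B D \<longrightarrow> (\<forall>i\<in>{1..k} - \<Union>\<pi>. x i \<in> sp n) \<longrightarrow>
       contract B D \<pi> (ad_trace_form n k) x = trace_poly_val n x L"
    using insert.IH[OF pairs dis] by blast
  have P: "P \<subseteq> {1..k}" "card P = 2" using insert.prems(1) by auto
  obtain a b where ab: "P = {a, b}" "a < b"
  proof -
    obtain u v where uv: "P = {u, v}" "u \<noteq> v" using P(2) unfolding card_2_iff by blast
    show thesis
    proof (cases "u < v")
      case True
      then show thesis using that uv by blast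
    next
      case False
      then show thesis using that[of v u] uv by (simp add: insert_commute)
    qed
  qed
  then have mm: "Min P = a" "Max P = b" by auto
  have "P \<inter> Q = {}" if "Q \<in> \<pi>" for Q
  proof -
    have "P \<noteq> Q" using that insert.hyps(2) by blast
    then show ?thesis
      using insert.prems(2)[unfolded disjoint_def, rule_format, of P Q] that by simp
  qed
  moreover have "a \<in> P" "b \<in> P" using ab(1) by auto
  ultimately have mem: "a \<in> {1..k} - \<Union>\<pi>" "b \<in> {1..k} - \<Union>\<pi>" using P(1) by blast+
  have I: "{1..k} - \<Union>\<pi> - {a, b} = {1..k} - \<Union>(insert P \<pi>)" using ab(1) by blast
  obtain L' :: "'a trace_poly" where L': "multilinear_in ({1..k} - \<Union>(insert P \<pi>)) L'"
    and contr: "\<forall>n B D x. sp_dual_basis n B D \<longrightarrow> (\<forall>i\<in>{1..k} - \<Union>(insert P \<pi>). x i \<in> sp n) \<longrightarrow>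
       (\<Sum>\<alpha>\<in>B. trace_poly_val n (x(a := \<alpha>, b := D \<alpha>)) L) = trace_poly_val n x L'"
    using contract_trace_poly[OF L mem less_imp_neq[OF ab(2)]] unfolding I by blast
  have "contract B D (insert P \<pi>) (ad_trace_form n k) x = trace_poly_val n x L'"
    if db: "sp_dual_basis n B D" and x: "\<forall>i\<in>{1..k} - \<Union>(insert P \<pi>). x i \<in> sp n"
    for n B D and x :: "nat \<Rightarrow> 'a mat"
  proof -
    interpret sp_dual_basis n B D by (rule db)
    have "contract B D (insert P \<pi>) (ad_trace_form n k)
      = contract_pair B D P (contract B D \<pi> (ad_trace_form n k))"
      by (rule contract_insert[OF insert.prems(2) _ insert.hyps(1,2)])
         (use insert.prems(1) in blast)
    then have "contract B D (insert P \<pi>) (ad_trace_form n k) x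
      = (\<Sum>\<alpha>\<in>B. contract B D \<pi> (ad_trace_form n k) (x(a := \<alpha>, b := D \<alpha>)))"
      by (simp only: contract_pair_def mm)
    also have "\<dots> = (\<Sum>\<alpha>\<in>B. trace_poly_val n (x(a := \<alpha>, b := D \<alpha>)) L)"
    proof (intro sum.cong refl val[rule_format, OF db])
      fix \<alpha> i assume "\<alpha> \<in> B" "i \<in> {1..k} - \<Union>\<pi>"
      then show "(x(a := \<alpha>, b := D \<alpha>)) i \<in> sp n"
        using x[rule_format, of i] B_sub D_sp ab(1) by (cases "i = b"; cases "i = a") (simp_all add: subset_iff)
    qed
    also have "\<dots> = trace_poly_val n x L'" by (rule contr[rule_format, OF db x[rule_format]])
    finally show ?thesis .
  qed
  with L' show ?case by (intro exI[of _ L']) simp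
qed

section \<open>Polynomial dependence on the dimension\<close>

text \<open>Empty words are removed at the price of a factor \<open>2 n\<close> each, and the coefficients of equal
  expressions are added up.\<close>
lemma trace_poly_val_to_exprs:
  fixes L :: "'a::field_char_0 trace_poly"
  assumes "multilinear_in I L"
  shows "\<exists>(S :: trace_expr set) (p :: trace_expr \<Rightarrow> 'a poly). finite S \<and> (\<forall>T\<in>S. trace_expr_over I T) \<and>
    (\<forall>n x. trace_poly_val n x L = (\<Sum>T\<in>S. poly (p T) (of_nat n) * trace_expr_val (2 * n) x T))"
  using assms
proof (induction L)
  case Nil
  show ?case by (rule exI[of _ "{}"]) simp
next
  case (Cons rT L)
  obtain r T0 where rT: "rT = (r, T0)" by (cases rT)
  have T0: "set (concat T0) = I" and "multilinear_in I L"
    using Cons.prems by (auto simp: multilinear_in_def rT)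
  with Cons.IH obtain S and p :: "trace_expr \<Rightarrow> 'a poly" where S: "finite S" "\<forall>T\<in>S. trace_expr_over I T"
    and val: "\<And>n x. trace_poly_val n x L = (\<Sum>T\<in>S. poly (p T) (of_nat n) * trace_expr_val (2 * n) x T)"
    by blast
  define T1 where "T1 = map (map Plain) (filter (\<lambda>w. w \<noteq> []) T0)"
  define p1 :: "'a poly" where "p1 = r * [:0, 2:] ^ length (filter (\<lambda>w. w = []) T0)"
  have T1: "trace_expr_over I T1"
    using T0 by (auto simp: trace_expr_over_def T1_def)
  have v: "monomial_val (2 * n) x T
      = poly ([:0, 2:] ^ length (filter (\<lambda>w. w = []) T)) (of_nat n)
        * trace_expr_val (2 * n) x (map (map Plain) (filter (\<lambda>w. w \<noteq> []) T))"
    for n T and x :: "nat \<Rightarrow> 'a mat"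
    by (induction T) (auto simp: trace_expr_val_def word_val_Plain mtrace_one)
  define p' where "p' T = (if T \<in> S then p T else 0) + (if T = T1 then p1 else 0)" for T
  have "trace_poly_val n x (rT # L) = (\<Sum>T\<in>insert T1 S. poly (p' T) (of_nat n) * trace_expr_val (2 * n) x T)" for n x
  proof -
    let ?v = "trace_expr_val (2 * n) x"
    have "(\<Sum>T\<in>insert T1 S. poly (p' T) (of_nat n) * ?v T)
       = (\<Sum>T\<in>insert T1 S. if T \<in> S then poly (p T) (of_nat n) * ?v T else 0)
         + (\<Sum>T\<in>insert T1 S. if T = T1 then poly p1 (of_nat n) * ?v T else 0)"
      unfolding sum.distrib[symmetric] by (intro sum.cong refl) (simp add: p'_def algebra_simps)
    also have "(\<Sum>T\<in>insert T1 S. if T \<in> S then poly (p T) (of_nat n) * ?v T else 0)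
       = (\<Sum>T\<in>S. poly (p T) (of_nat n) * ?v T)"
      using S(1) by (intro sum.mono_neutral_cong_right) auto
    also have "(\<Sum>T\<in>insert T1 S. if T = T1 then poly p1 (of_nat n) * ?v T else 0) = poly p1 (of_nat n) * ?v T1"
      using S(1) by (subst sum.delta) auto
    finally show ?thesis
      by (simp add: rT val v[of n x T0] p1_def T1_def)
  qed
  moreover have "finite (insert T1 S)" "\<forall>T\<in>insert T1 S. trace_expr_over I T" using S T1 by auto
  ultimately show ?case by blast
qed

theorem theorem8:
  fixes k q :: nat and \<pi> :: "nat set set"
  assumes "\<And>P. P \<in> \<pi> \<Longrightarrow> P \<subseteq> {1..k} \<and> card P = 2"
    and "disjoint \<pi>"
    and "card \<pi> = q"
  shows "\<exists>(S :: trace_expr set) (p :: trace_expr \<Rightarrow> 'a::field_char_0 poly).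
    finite S \<and> (\<forall>T\<in>S. trace_expr_over ({1..k} - \<Union>\<pi>) T) \<and>
    (\<forall>n\<ge>1. \<forall>(B :: 'a mat set) D (x :: nat \<Rightarrow> 'a mat).
       vectorspace.basis class_ring (sp_space n) B \<and> dual_basis n B D \<and>
       (\<forall>i\<in>{1..k} - \<Union>\<pi>. x i \<in> sp n) \<longrightarrow>
       contract B D \<pi> (ad_trace_form n k) x =
         (\<Sum>T\<in>S. poly (p T) (of_nat n) * trace_expr_val (2 * n) x T))"
proof -
  have "\<pi> \<subseteq> Pow {1..k}"
  proof
    fix P assume "P \<in> \<pi>"
    then show "P \<in> Pow {1..k}" using assms(1)[of P] by simp
  qed
  then have "finite \<pi>" by (rule finite_subset) simp
  then have "\<exists>L :: 'a trace_poly. multilinear_in ({1..k} - \<Union>\<pi>) L \<and>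
    (\<forall>n B D x. sp_dual_basis n B D \<longrightarrow> (\<forall>i\<in>{1..k} - \<Union>\<pi>. x i \<in> sp n) \<longrightarrow>
       contract B D \<pi> (ad_trace_form n k) x = trace_poly_val n x L)"
    by (rule contract_ad_trace_form[OF _ assms(1,2)])
  then obtain L :: "'a trace_poly" where L: "multilinear_in ({1..k} - \<Union>\<pi>) L"
    and val: "\<forall>n B D x. sp_dual_basis n B D \<longrightarrow> (\<forall>i\<in>{1..k} - \<Union>\<pi>. x i \<in> sp n) \<longrightarrow>
       contract B D \<pi> (ad_trace_form n k) x = trace_poly_val n x L"
    by blast
  obtain S and p :: "trace_expr \<Rightarrow> 'a poly" where S: "finite S" "\<forall>T\<in>S. trace_expr_over ({1..k} - \<Union>\<pi>) T"
    and conv: "\<And>n x. trace_poly_val n x L = (\<Sum>T\<in>S. poly (p T) (of_nat n) * trace_expr_val (2 * n) x T)"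
    using trace_poly_val_to_exprs[OF L] by blast
  have "contract B D \<pi> (ad_trace_form n k) x = (\<Sum>T\<in>S. poly (p T) (of_nat n) * trace_expr_val (2 * n) x T)"
    if "vectorspace.basis class_ring (sp_space n) B" "dual_basis n B D" "\<forall>i\<in>{1..k} - \<Union>\<pi>. x i \<in> sp n"
    for n B D and x :: "nat \<Rightarrow> 'a mat"
    using val[rule_format, OF sp_dual_basis.intro[OF that(1,2)] that(3)[rule_format]] conv by (simp only:)
  with S show ?thesis by (intro exI[of _ S] exI[of _ p]) simp
qed

end
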